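(* Let $b\in\{N,D\}$ and $T>0$. (i) There exists $C_5(T)>0$ such that for all $(t,x,y)\in(0,T]\times[0,1]^2$ $$p_t^b(x,y)\le C_5(T)\,t^{-\gamma\delta}.$$ (ii) There exists $C_6(T)>0$ such that for all $(t,x,x',y)\in(0,T]\times[0,1]^3$ $$\left|p_t^b(x,y)-p_t^b(x',y)\right|\le C_6(T)\,|x-x'|^{\frac12}\,t^{-\frac12-\frac{\gamma\delta}2}.$$ (iii) There exists $C_7(T)>0$ such that for all $(s,t,x)\in(0,T]^2\times[0,1]$ with $s\le t$ $$\left|p_s^b(x,x)-p_t^b(x,x)\right|\le C_7(T)\left(s^{-\gamma\delta}-t^{-\gamma\delta}\right).$$
   Context: **Measure.** Let $N\ge2$ and let $S_i(x)=r_ix+b_i$, $i=1,\dots,N$, with $0<r_i<1$, $0\le b_i\le 1-r_i$, be affine contractions of $[0,1]$ with $0=S_1(0)<S_1(1)\le S_2(0)<S_2(1)\le\dots<S_N(1)=1$. Let $\mu_1,\dots,\mu_N\in(0,1)$ with $\sum_i\mu_i=1$. Let $\mu$ be the unique Borel probability measure on $[0,1]$ with $\mu(A)=\sum_{i=1}^N\mu_i\,\mu(S_i^{-1}(A))$ for all Borel $A$. Put $\mathcal H=L^2([0,1],\mu)$. The spectral exponent $\gamma$ is the unique solution of $\sum_{i=1}^N(\mu_ir_i)^\gamma=1$, and $\delta=\max_{1\le i\le N}\frac{\log\mu_i}{\log((\mu_ir_i)^\gamma)}$. **Operator.** $\mathcal D_\mu^2$ is the set of $h\in C^1[0,1]$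 for which there is a $\mu$-square-integrable function $(h')^\mu$ with $h'(x)=h'(0)+\int_0^x(h')^\mu\,d\mu$ for $x\in[0,1]$; $\Delta_\mu h=(h')^\mu$. $\Delta_\mu^N$ (resp. $\Delta_\mu^D$) is the restriction of $\Delta_\mu$ to classes in $\mathcal H$ having a representative $\bar h\in\mathcal D_\mu^2$ with $\bar h'(0)=\bar h'(1)=0$ (resp. $\bar h(0)=\bar h(1)=0$). $-\Delta_\mu^b$ is self-adjoint and non-negative on $\mathcal H$; there is an orthonormal basis $(\varphi_k^b)_{k\ge1}$ of $\mathcal H$ of eigenfunctions of $-\Delta_\mu^b$ with eigenvalues $0\le\lambda_1^b\le\lambda_2^b\le\cdots$, where $\varphi_k^b$ is taken as its representative in $\mathcal D^2_\mu$. The heat kernel is $p_t^b(x,y)=\sum_{k\ge1}e^{-\lambda_k^bt}\varphi_k^b(x)\varphi_k^b(y)$ for $t>0$, $x,y\in[0,1]$. *)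

theory Defs
  imports "HOL-Probability.Probability"
begin

text \<open>The maps are \<open>S\<^sub>i x = r i * x + b i\<close> for \<open>i \<in> {1..N}\<close>; values of \<open>r\<close>, \<open>b\<close> and of the
  weights \<open>m\<close> at other indices play no role.\<close>

definition affine_map :: "(nat \<Rightarrow> real) \<Rightarrow> (nat \<Rightarrow> real) \<Rightarrow> nat \<Rightarrow> real \<Rightarrow> real" where
  "affine_map r b i x = r i * x + b i"

definition affine_ifs :: "nat \<Rightarrow> (nat \<Rightarrow> real) \<Rightarrow> (nat \<Rightarrow> real) \<Rightarrow> bool" where
  "affine_ifs N r b \<longleftrightarrow>
     2 \<le> N \<and>
     (\<forall>i\<in>{1..N}. 0 < r i \<and> r i < 1 \<and> 0 \<le> b i \<and> b i \<le> 1 - r i) \<and>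
     affine_map r b 1 0 = 0 \<and>
     (\<forall>i\<in>{1..N}. affine_map r b i 0 < affine_map r b i 1) \<and>
     (\<forall>i\<in>{1..<N}. affine_map r b i 1 \<le> affine_map r b (Suc i) 0) \<and>
     affine_map r b N 1 = 1"

definition probability_weights :: "nat \<Rightarrow> (nat \<Rightarrow> real) \<Rightarrow> bool" where
  "probability_weights N m \<longleftrightarrow> (\<forall>i\<in>{1..N}. 0 < m i \<and> m i < 1) \<and> (\<Sum>i=1..N. m i) = 1"

definition self_similar_measure ::
  "nat \<Rightarrow> (nat \<Rightarrow> real) \<Rightarrow> (nat \<Rightarrow> real) \<Rightarrow> (nat \<Rightarrow> real) \<Rightarrow> real measure \<Rightarrow> bool" where
  "self_similar_measure N r b m \<mu> \<longleftrightarrow>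
     prob_space \<mu> \<and>
     sets \<mu> = sets (restrict_space borel {0..1}) \<and>
     (\<forall>A\<in>sets \<mu>. measure \<mu> A = (\<Sum>i=1..N. m i * measure \<mu> (affine_map r b i -` A \<inter> {0..1})))"

definition spectral_exponent :: "nat \<Rightarrow> (nat \<Rightarrow> real) \<Rightarrow> (nat \<Rightarrow> real) \<Rightarrow> real" where
  "spectral_exponent N r m = (THE \<gamma>. (\<Sum>i=1..N. (m i * r i) powr \<gamma>) = 1)"

definition spectral_delta :: "nat \<Rightarrow> (nat \<Rightarrow> real) \<Rightarrow> (nat \<Rightarrow> real) \<Rightarrow> real" where
  "spectral_delta N r m =
     Max ((\<lambda>i. ln (m i) / ln ((m i * r i) powr spectral_exponent N r m)) ` {1..N})"

text \<open>Elements of \<open>L\<^sup>2([0,1], \<mu>)\<close> are represented by square-integrable functions, and equality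
  in \<open>L\<^sup>2\<close> is equality \<open>\<mu>\<close>-almost everywhere.\<close>

definition sq_integrable :: "real measure \<Rightarrow> (real \<Rightarrow> real) \<Rightarrow> bool" where
  "sq_integrable \<mu> f \<longleftrightarrow> f \<in> borel_measurable \<mu> \<and> integrable \<mu> (\<lambda>x. (f x)\<^sup>2)"

definition L2_inner :: "real measure \<Rightarrow> (real \<Rightarrow> real) \<Rightarrow> (real \<Rightarrow> real) \<Rightarrow> real" where
  "L2_inner \<mu> f g = (LINT x|\<mu>. f x * g x)"

definition orthonormal_basis :: "real measure \<Rightarrow> (nat \<Rightarrow> real \<Rightarrow> real) \<Rightarrow> bool" where
  "orthonormal_basis \<mu> \<phi> \<longleftrightarrow>
     (\<forall>k. sq_integrable \<mu> (\<phi> k)) \<and>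
     (\<forall>j k. L2_inner \<mu> (\<phi> j) (\<phi> k) = (if j = k then 1 else 0)) \<and>
     (\<forall>f. sq_integrable \<mu> f \<longrightarrow>
        (\<lambda>n. LINT x|\<mu>. (f x - (\<Sum>k<n. L2_inner \<mu> f (\<phi> k) * \<phi> k x))\<^sup>2) \<longlonglongrightarrow> 0)"

text \<open>The derivative on \<open>[0,1]\<close> is one-sided at the endpoints, so that only the values of a
  function on \<open>[0,1]\<close> matter.\<close>

definition deriv01 :: "(real \<Rightarrow> real) \<Rightarrow> real \<Rightarrow> real" where
  "deriv01 h x = vector_derivative h (at x within {0..1})"

definition C1_01 :: "(real \<Rightarrow> real) set" where
  "C1_01 = {h. h differentiable_on {0..1} \<and> continuous_on {0..1} (deriv01 h)}"

definition has_measure_derivative ::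
  "real measure \<Rightarrow> (real \<Rightarrow> real) \<Rightarrow> (real \<Rightarrow> real) \<Rightarrow> bool" where
  "has_measure_derivative \<mu> f g \<longleftrightarrow>
     sq_integrable \<mu> g \<and> (\<forall>x\<in>{0..1}. f x = f 0 + (LINT y:{0..x}|\<mu>. g y))"

definition D2 :: "real measure \<Rightarrow> (real \<Rightarrow> real) set" where
  "D2 \<mu> = {h \<in> C1_01. \<exists>g. has_measure_derivative \<mu> (deriv01 h) g}"

datatype boundary = Neumann | Dirichlet

fun boundary_condition :: "boundary \<Rightarrow> (real \<Rightarrow> real) \<Rightarrow> bool" where
  "boundary_condition Neumann h \<longleftrightarrow> deriv01 h 0 = 0 \<and> deriv01 h 1 = 0"
| "boundary_condition Dirichlet h \<longleftrightarrow> h 0 = 0 \<and> h 1 = 0"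

text \<open>The graph of the operator \<open>\<Delta>\<^sub>\<mu>\<close> with boundary condition \<open>\<beta>\<close>: the class of \<open>f\<close> is in the
  domain and is mapped to the class of \<open>u\<close>. The relation is invariant under changing \<open>f\<close> and \<open>u\<close>
  (measurably) on \<open>\<mu>\<close>-null sets.\<close>

definition laplacian :: "real measure \<Rightarrow> boundary \<Rightarrow> (real \<Rightarrow> real) \<Rightarrow> (real \<Rightarrow> real) \<Rightarrow> bool" where
  "laplacian \<mu> \<beta> f u \<longleftrightarrow>
     sq_integrable \<mu> f \<and>
     (\<exists>h\<in>D2 \<mu>. (AE x in \<mu>. f x = h x) \<and> boundary_condition \<beta> h \<and>
               has_measure_derivative \<mu> (deriv01 h) u)"

definition eigenfunction :: "real measure \<Rightarrow> boundary \<Rightarrow> real \<Rightarrow> (real \<Rightarrow> real) \<Rightarrow> bool" where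
  "eigenfunction \<mu> \<beta> l f \<longleftrightarrow>
     \<not> (AE x in \<mu>. f x = 0) \<and>
     (\<exists>u. laplacian \<mu> \<beta> f u \<and> (AE x in \<mu>. - u x = l * f x))"

text \<open>Enumerations start at \<open>0\<close>: \<open>\<Lambda> k\<close> and \<open>\<phi> k\<close> are the \<open>(k+1)\<close>-st eigenvalue and eigenfunction.
  Each \<open>\<phi> k\<close> is the representative of its class in \<open>D2 \<mu>\<close>, so its values on \<open>[0,1]\<close> are meaningful
  pointwise.\<close>

definition eigenbasis ::
  "real measure \<Rightarrow> boundary \<Rightarrow> (nat \<Rightarrow> real) \<Rightarrow> (nat \<Rightarrow> real \<Rightarrow> real) \<Rightarrow> bool" where
  "eigenbasis \<mu> \<beta> \<Lambda> \<phi> \<longleftrightarrow>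
     orthonormal_basis \<mu> \<phi> \<and>
     (\<forall>k. \<phi> k \<in> D2 \<mu> \<and> eigenfunction \<mu> \<beta> (\<Lambda> k) (\<phi> k)) \<and>
     0 \<le> \<Lambda> 0 \<and> mono \<Lambda>"

definition heat_kernel ::
  "(nat \<Rightarrow> real) \<Rightarrow> (nat \<Rightarrow> real \<Rightarrow> real) \<Rightarrow> real \<Rightarrow> real \<Rightarrow> real \<Rightarrow> real" where
  "heat_kernel \<Lambda> \<phi> t x y = (\<Sum>k. exp (- \<Lambda> k * t) * \<phi> k x * \<phi> k y)"

end

theory Submission
  imports Defs
begin

text \<open>
  Put \<open>\<theta> = \<gamma> \<delta>\<close>. The spectral exponent cancels in this product, leaving
  \<open>\<theta> = max\<^sub>i ln m\<^sub>i / ln (m\<^sub>i r\<^sub>i)\<close>, so \<open>0 < \<theta> < 1\<close> and every map satisfies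
  \<open>(m\<^sub>i r\<^sub>i) powr \<theta> \<le> m\<^sub>i\<close>. By self-similarity, a cell of any generation with length \<open>\<rho>\<close> then has mass
  at least \<open>(p \<rho>) powr \<theta>\<close>, where \<open>p\<close> is its product weight. Stopping the subdivision when \<open>p \<rho>\<close>
  is comparable to \<open>t\<close> puts every point of the support into a cell with mass at least
  \<open>t powr \<theta>\<close> and length at most a constant times \<open>t powr (1 - \<theta>)\<close>.

  Comparing \<open>f x\<close> with the values of \<open>f\<close> on such a cell and averaging against \<open>\<mu>\<close> gives the
  Sobolev inequality (lemma \<open>sobolev\<close>)
  \<open>(f x)\<^sup>2 \<le> C t powr (- \<theta>) (\<parallel>f\<parallel>\<^sup>2 + t \<E> f)\<close>, with \<open>\<E> f\<close> the Dirichlet integral \<open>\<integral> (f')\<^sup>2 dx\<close>. Points in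
  the gaps of the support cost nothing: functions in the domain of \<open>\<Delta>\<^sub>\<mu>\<close> are affine on \<open>\<mu>\<close>-null
  intervals, so they are controlled there by their values at the ends.

  Green's formula makes the derivatives of the eigenfunctions orthogonal in \<open>L\<^sup>2(dx)\<close>, so
  \<open>f = \<Sum> c\<^sub>k \<phi>\<^sub>k\<close> has \<open>\<parallel>f\<parallel>\<^sup>2 + t \<E> f = \<Sum> (1 + t \<lambda>\<^sub>k) c\<^sub>k\<^sup>2\<close>. Choosing the coefficients
  \<open>c\<^sub>k = \<phi>\<^sub>k x / (1 + t \<lambda>\<^sub>k)\<close> turns the Sobolev inequality into an inequality of the form
  \<open>R\<^sup>2 \<le> B R\<close> for \<open>R = \<Sum>\<^sub>k \<phi>\<^sub>k(x)\<^sup>2 / (1 + t \<lambda>\<^sub>k)\<close>, hence \<open>R \<le> C t powr (- \<theta>)\<close> (lemma \<open>resolvent_le\<close>).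
  This bound on the diagonal of the resolvent, uniform in the number of terms, carries all
  three claims, because the relevant exponentials are at most a constant times
  \<open>1 / (1 + t \<lambda>)\<close>:
  \<open>exp (- t \<lambda>)\<close> for the size of the kernel, \<open>t \<lambda> exp (- 2 t \<lambda>)\<close> for the energy of
  \<open>x \<mapsto> p\<^sub>t(x, y)\<close>, whose square root bounds its Hoelder-\<open>1/2\<close> seminorm, and
  \<open>t \<lambda> exp (- t \<lambda>)\<close> for the time derivative of \<open>p\<^sub>t(x, x)\<close>, which is integrated from \<open>s\<close> to \<open>t\<close>.
\<close>

section \<open>The Dirichlet integral of a continuously differentiable function\<close>

lemma deriv01_eqI:
  assumes "(f has_real_derivative D) (at x within {0..1})" "x \<in> {0..1}"
  shows "deriv01 f x = D"
  using vector_derivative_within_cbox[of 0 1 x f D] assms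
  by (simp add: deriv01_def has_real_derivative_iff_has_vector_derivative)

text \<open>The argument is the derivative and not the function, so that the energy of a finite sum can be
  computed from the explicit sum of the derivatives.\<close>

definition energy :: "(real \<Rightarrow> real) \<Rightarrow> real" where
  "energy f' = integral {0..1} (\<lambda>x. (f' x)\<^sup>2)"

text \<open>Carrying the derivative as a separate function keeps linear combinations simple; on \<open>[0,1]\<close> it
  is necessarily \<^term>\<open>deriv01 f\<close>, by \<open>deriv01_eqI\<close>.\<close>

definition C1_pair :: "(real \<Rightarrow> real) \<Rightarrow> (real \<Rightarrow> real) \<Rightarrow> bool" where
  "C1_pair f f' \<longleftrightarrow>
     (\<forall>x\<in>{0..1}. (f has_real_derivative f' x) (at x within {0..1})) \<and> continuous_on {0..1} f'"

lemma C1_pairD: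
  assumes "C1_pair f f'"
  shows "x \<in> {0..1} \<Longrightarrow> (f has_real_derivative f' x) (at x within {0..1})"
    and "continuous_on {0..1} f'" "continuous_on {0..1} f"
  using assms by (auto simp: C1_pair_def intro!: DERIV_continuous_on)

lemma C1_pair_deriv01: "f \<in> C1_01 \<Longrightarrow> C1_pair f (deriv01 f)"
  by (auto simp: C1_pair_def C1_01_def deriv01_def differentiable_on_def
      has_real_derivative_iff_has_vector_derivative vector_derivative_works[symmetric])

lemma C1_pair_integral:
  assumes "C1_pair f f'" "0 \<le> a" "a \<le> c" "c \<le> 1"
  shows "(f' has_integral f c - f a) {a..c}"
proof (rule fundamental_theorem_of_calculus[OF \<open>a \<le> c\<close>])
  fix x assume "x \<in> {a..c}"
  then show "(f has_vector_derivative f' x) (at x within {a..c})"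
    using C1_pairD(1)[OF assms(1), of x] assms
    by (auto simp: has_real_derivative_iff_has_vector_derivative
        intro: has_vector_derivative_within_subset)
qed

lemma energy_nonneg: "0 \<le> energy f'"
  unfolding energy_def
  by (cases "(\<lambda>x. (f' x)\<^sup>2) integrable_on {0..1}")
    (auto simp: not_integrable_integral intro: integral_nonneg)

text \<open>This is the Cauchy-Schwarz inequality for \<open>f c - f a = \<integral>\<^sub>a\<^sup>c f'\<close>. It is obtained by integrating
  \<open>(f' - k)\<^sup>2 \<ge> 0\<close> with \<open>k\<close> the mean of \<open>f'\<close> over \<open>[a,c]\<close>, which leaves continuous integrands only.\<close>

lemma square_increment_le_energy:
  assumes "C1_pair f f'" "0 \<le> a" "a < c" "c \<le> 1"
  shows "(f c - f a)\<^sup>2 \<le> (c - a) * energy f'"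
proof -
  define k where "k = (f c - f a) / (c - a)"
  have cont: "continuous_on {0..1} f'"
    using C1_pairD[OF assms(1)] by blast
  have cont': "continuous_on {a..c} f'"
    using cont assms by (auto intro: continuous_on_subset)
  have sq: "(\<lambda>x. (f' x)\<^sup>2) integrable_on {0..1}" "(\<lambda>x. (f' x)\<^sup>2) integrable_on {a..c}"
    using cont cont' by (auto intro!: integrable_continuous_interval continuous_intros)
  have "((\<lambda>x. (f' x)\<^sup>2 - 2 * k * f' x + k\<^sup>2) has_integral
      integral {a..c} (\<lambda>x. (f' x)\<^sup>2) - 2 * k * (f c - f a) + (c - a) * k\<^sup>2) {a..c}"
    using assms C1_pair_integral[OF assms(1,2) _ assms(4)] sq
      has_integral_const_real[of "k\<^sup>2" a c]
    by (intro has_integral_add has_integral_diff has_integral_mult_right)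
      (auto intro: integrable_integral)
  then have "0 \<le> integral {a..c} (\<lambda>x. (f' x)\<^sup>2) - 2 * k * (f c - f a) + (c - a) * k\<^sup>2"
  proof (rule has_integral_nonneg)
    fix x
    have "(f' x)\<^sup>2 - 2 * k * f' x + k\<^sup>2 = (f' x - k)\<^sup>2"
      by (simp add: power2_eq_square algebra_simps)
    then show "0 \<le> (f' x)\<^sup>2 - 2 * k * f' x + k\<^sup>2"
      by simp
  qed
  moreover have "f c - f a = k * (c - a)"
    using assms by (simp add: k_def)
  ultimately have "(c - a) * k\<^sup>2 \<le> integral {a..c} (\<lambda>x. (f' x)\<^sup>2)"
    by (simp add: power2_eq_square algebra_simps)
  also have "\<dots> \<le> energy f'"
    unfolding energy_def using assms sq by (intro integral_subset_le) auto
  finally have "(c - a) * ((c - a) * k\<^sup>2) \<le> (c - a) * energy f'"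
    using assms by (intro mult_left_mono) auto
  moreover have "(f c - f a)\<^sup>2 = (c - a) * ((c - a) * k\<^sup>2)"
    unfolding \<open>f c - f a = k * (c - a)\<close> by (simp add: power2_eq_square algebra_simps)
  ultimately show ?thesis
    by simp
qed

lemma square_diff_le_energy:
  assumes "C1_pair f f'" "x \<in> {0..1}" "y \<in> {0..1}"
  shows "(f x - f y)\<^sup>2 \<le> \<bar>x - y\<bar> * energy f'"
proof (cases x y rule: linorder_cases)
  case less
  then show ?thesis
    using square_increment_le_energy[OF assms(1), of x y] assms by (simp add: power2_commute)
next
  case greater
  then show ?thesis
    using square_increment_le_energy[OF assms(1), of y x] assms by simp
qed simp

section \<open>Probability measures on the unit interval\<close>

locale unit_prob = prob_space \<mu> for \<mu> :: "real measure" +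
  assumes sets_mu: "sets \<mu> = sets (restrict_space borel {0..1})"
begin

lemma space_mu: "space \<mu> = {0..1}"
  using sets_eq_imp_space_eq[OF sets_mu] by (simp add: space_restrict_space)

lemma sets_muI: "A \<in> sets borel \<Longrightarrow> A \<subseteq> {0..1} \<Longrightarrow> A \<in> sets \<mu>"
  by (auto simp: sets_mu sets_restrict_space_iff)

lemma measurable_mu_id: "(\<lambda>x. x) \<in> borel_measurable \<mu>"
  by (subst measurable_cong_sets[OF sets_mu refl]) (auto intro: measurable_restrict_space1)

lemma continuous_integrable:
  assumes "continuous_on {0..1} (f :: real \<Rightarrow> real)"
  shows "integrable \<mu> f"
proof -
  have "f \<in> borel_measurable \<mu>"
    using borel_measurable_continuous_on_restrict[OF assms] measurable_cong_sets[OF sets_mu refl]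
    by blast
  moreover have "bounded (f ` {0..1})"
    using assms by (intro compact_imp_bounded compact_continuous_image) auto
  then obtain B where "\<forall>x\<in>{0..1}. norm (f x) \<le> B"
    by (auto simp: bounded_iff)
  ultimately show ?thesis
    using space_mu by (intro integrable_const_bound[where B = B]) (auto intro: AE_I2)
qed

lemma sq_integrable_integrable: "sq_integrable \<mu> u \<Longrightarrow> integrable \<mu> u"
  unfolding sq_integrable_def by (metis square_integrable_imp_integrable)

lemma has_measure_derivativeD:
  assumes "has_measure_derivative \<mu> g u"
  shows "sq_integrable \<mu> u" "integrable \<mu> u"
    and "x \<in> {0..1} \<Longrightarrow> g x = g 0 + (LINT y:{0..x}|\<mu>. u y)"
  using assms sq_integrable_integrable unfolding has_measure_derivative_def by blast+

text \<open>Only open intervals are used, so the integral of the \<open>\<mu>\<close>-derivative between two interior points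
  runs over a null set, whatever the mass of the end points.\<close>

lemma has_measure_derivative_const_on_null_interval:
  assumes u: "has_measure_derivative \<mu> g u"
    and null: "measure \<mu> {a<..<c} = 0"
    and "0 \<le> a" "a < x" "x \<le> y" "y < c" "c \<le> 1"
  shows "g x = g y"
proof -
  have "{a<..<c} \<in> null_sets \<mu>"
    using assms by (auto simp: null_sets_def emeasure_eq_measure intro!: sets_muI)
  then have ae: "AE z in \<mu>. z \<notin> {a<..<c}"
    by (rule AE_not_in)
  have int: "integrable \<mu> u"
    using u by (rule has_measure_derivativeD)
  have int': "integrable \<mu> (\<lambda>z. indicator {0..w} z *\<^sub>R u z)" if "w \<le> 1" for w
    using int that by (intro integrable_mult_indicator sets_muI) auto
  have "(LINT z:{0..x}|\<mu>. u z) = (LINT z:{0..y}|\<mu>. u z)"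
    unfolding set_lebesgue_integral_def
  proof (rule integral_cong_AE)
    show "AE z in \<mu>. indicator {0..x} z *\<^sub>R u z = indicator {0..y} z *\<^sub>R u z"
      using ae by eventually_elim (use assms in \<open>auto simp: indicator_def\<close>)
    show "(\<lambda>z. indicator {0..x} z *\<^sub>R u z) \<in> borel_measurable \<mu>"
      "(\<lambda>z. indicator {0..y} z *\<^sub>R u z) \<in> borel_measurable \<mu>"
      by (rule borel_measurable_integrable, rule int', use assms in linarith)+
  qed
  then show ?thesis
    using has_measure_derivativeD(3)[OF u, of x] has_measure_derivativeD(3)[OF u, of y] assms
    by simp
qed

text \<open>A function whose derivative has a \<open>\<mu>\<close>-derivative is affine on a null interval, hence bounded
  there by its larger end value. The mean value theorem on either side of \<open>x\<close> yields slopes that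
  coincide, and \<open>f x\<close> becomes a convex combination of the end values.\<close>

lemma abs_le_on_null_interval:
  assumes f: "C1_pair f f'" and u: "has_measure_derivative \<mu> f' u"
    and null: "measure \<mu> {a<..<c} = 0" and "0 \<le> a" "a \<le> x" "x \<le> c" "c \<le> 1"
  shows "\<bar>f x\<bar> \<le> max \<bar>f a\<bar> \<bar>f c\<bar>"
proof (cases "x = a \<or> x = c")
  case False
  then have x: "a < x" "x < c"
    using assms by auto
  have D: "(f has_real_derivative f' z) (at z)" if "a < z" "z < c" for z
    using C1_pairD(1)[OF f, of z] at_within_interior[of z "{0..1}"] that assms by simp
  have mean_value: "\<exists>l>v. l < w \<and> f w - f v = (w - v) * f' l"
    if "a \<le> v" "v < w" "w \<le> c" for v w
  proof -
    have "continuous_on {v..w} f"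
      using C1_pairD(3)[OF f] that assms by (auto intro: continuous_on_subset)
    moreover have "f differentiable (at z)" if "v < z" "z < w" for z
      unfolding real_differentiable_def using D[of z] that \<open>a \<le> v\<close> \<open>w \<le> c\<close> by auto
    ultimately obtain d l where "v < l" "l < w" "DERIV f l :> d" "f w - f v = (w - v) * d"
      using MVT[OF \<open>v < w\<close>, of f] by blast
    then show ?thesis
      using D[of l] that by (auto dest: DERIV_unique)
  qed
  obtain l where l: "a < l" "l < x" "f x - f a = (x - a) * f' l"
    using mean_value[of a x] x by auto
  obtain k where k: "x < k" "k < c" "f c - f x = (c - x) * f' k"
    using mean_value[of x c] x by auto
  have "f' l = f' k"
    using has_measure_derivative_const_on_null_interval[OF u null, of l k] l k x assms by auto
  define s where "s = (x - a) / (c - a)"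
  have s: "0 \<le> s" "s \<le> 1"
    using x by (auto simp: s_def)
  have "x - a = s * (c - a)"
    using x by (simp add: s_def)
  moreover have "f x = f a + (x - a) * f' k" "f c = f a + (c - a) * f' k"
    using l k \<open>f' l = f' k\<close> by (auto simp: algebra_simps)
  ultimately have "f x = f a + s * (f c - f a)"
    by simp
  then have "f x = (1 - s) * f a + s * f c"
    by (simp add: algebra_simps)
  then have "\<bar>f x\<bar> \<le> (1 - s) * \<bar>f a\<bar> + s * \<bar>f c\<bar>"
    using s abs_triangle_ineq[of "(1 - s) * f a" "s * f c"] by (simp add: abs_mult)
  also have "\<dots> \<le> (1 - s) * max \<bar>f a\<bar> \<bar>f c\<bar> + s * max \<bar>f a\<bar> \<bar>f c\<bar>"
    using s by (intro add_mono mult_left_mono) auto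
  finally show ?thesis
    by (simp add: algebra_simps)
qed auto

text \<open>The local form of the Sobolev inequality: for \<open>y\<close> in \<open>[u,v]\<close>,
  \<open>(f x)\<^sup>2 \<le> 2 (f y)\<^sup>2 + 2 (f x - f y)\<^sup>2 \<le> 2 (f y)\<^sup>2 + 2 (v - u) \<E> f\<close>, and this is integrated over \<open>[u,v]\<close>
  against \<open>\<mu>\<close>.\<close>

lemma square_times_mass_le:
  assumes f: "C1_pair f f'" and "0 \<le> u" "u \<le> x" "x \<le> v" "v \<le> 1"
  shows "(f x)\<^sup>2 * measure \<mu> {u..v} \<le>
    2 * (LINT y|\<mu>. (f y)\<^sup>2) + 2 * (v - u) * energy f' * measure \<mu> {u..v}"
proof -
  have cont: "continuous_on {0..1} f"
    using C1_pairD[OF f] by blast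
  have sq: "integrable \<mu> (\<lambda>y. (f y)\<^sup>2)"
    using cont by (intro continuous_integrable continuous_intros)
  have sets: "{u..v} \<in> sets \<mu>"
    using assms by (intro sets_muI) auto
  have pt: "((f x)\<^sup>2 - 2 * (v - u) * energy f') * indicator {u..v} y \<le> 2 * (f y)\<^sup>2" for y
  proof (cases "y \<in> {u..v}")
    case True
    have "(f x)\<^sup>2 \<le> 2 * (f y)\<^sup>2 + 2 * (f x - f y)\<^sup>2"
      using zero_le_power2[of "f x - 2 * f y"] by (simp add: power2_eq_square algebra_simps)
    also have "(f x - f y)\<^sup>2 \<le> \<bar>x - y\<bar> * energy f'"
      using True assms by (intro square_diff_le_energy) auto
    also have "\<bar>x - y\<bar> * energy f' \<le> (v - u) * energy f'"
      using True assms energy_nonneg by (intro mult_right_mono) auto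
    finally show ?thesis
      using True by (simp add: algebra_simps)
  qed simp
  have "((f x)\<^sup>2 - 2 * (v - u) * energy f') * measure \<mu> {u..v} =
      (LINT y|\<mu>. ((f x)\<^sup>2 - 2 * (v - u) * energy f') * indicator {u..v} y)"
    using sets sets.sets_into_space[OF sets] by (simp add: Int_absorb2)
  also have "\<dots> \<le> (LINT y|\<mu>. 2 * (f y)\<^sup>2)"
    using sq sets pt by (intro integral_mono) (auto simp: emeasure_eq_measure)
  finally show ?thesis
    by (simp add: algebra_simps)
qed

end

section \<open>Green's formula\<close>

context unit_prob
begin

text \<open>Insert \<open>g' x - g' 0 = \<integral> u d\<mu>\<close> (over \<open>[0,x]\<close>) and exchange the two integrations over the triangle
  \<open>y \<le> x\<close>: the inner integral of \<open>h'\<close> over \<open>[y,1]\<close> is \<open>h 1 - h y\<close>.\<close>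

lemma green_formula:
  assumes h: "C1_pair h h'" and g: "continuous_on {0..1} g'"
    and u: "has_measure_derivative \<mu> g' u"
  shows "integral {0..1} (\<lambda>x. h' x * g' x) = g' 1 * h 1 - g' 0 * h 0 - (LINT y|\<mu>. h y * u y)"
proof -
  interpret pair_sigma_finite lborel \<mu> ..
  define H :: "real \<Rightarrow> real" where "H = (\<lambda>x. indicator {0..1} x *\<^sub>R h' x)"
  have cont: "continuous_on {0..1} h" "continuous_on {0..1} h'"
    using C1_pairD[OF h] by blast+
  have intH: "integrable lborel H"
    using borel_integrable_atLeastAtMost'[OF cont(2)] by (simp add: H_def set_integrable_def)
  then have [measurable]: "H \<in> borel_measurable borel"
    using borel_measurable_integrable by force
  have intu: "integrable \<mu> u"
    using u by (rule has_measure_derivativeD)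
  then have [measurable]: "u \<in> borel_measurable \<mu>"
    by auto
  note [measurable] = measurable_mu_id
  \<comment> \<open>The integrand on the product space; the indicator cuts out the triangle.\<close>
  define F where "F = (\<lambda>x y. H x * (u y * indicator {..x} y))"
  have measF: "case_prod F \<in> borel_measurable (lborel \<Otimes>\<^sub>M \<mu>)"
  proof -
    have "(\<lambda>(x, y). H x * (u y * (if y \<le> x then 1 else 0))) \<in> borel_measurable (lborel \<Otimes>\<^sub>M \<mu>)"
      by measurable
    then show ?thesis
      by (simp add: F_def indicator_def)
  qed
  have "integrable (lborel \<Otimes>\<^sub>M \<mu>) (\<lambda>(x, y). H x * u y)"
    using intH intu by (intro Fubini_integrable) (auto simp: abs_mult)
  then have intF: "integrable (lborel \<Otimes>\<^sub>M \<mu>) (case_prod F)"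
    using measF by (rule Bochner_Integration.integrable_bound)
      (auto simp: F_def abs_mult indicator_def)
  have inner_mu: "(LINT y|\<mu>. F x y) = indicator {0..1} x *\<^sub>R (h' x * (g' x - g' 0))" for x
  proof (cases "x \<in> {0..1}")
    case True
    have "(LINT y|\<mu>. F x y) = H x * (LINT y|\<mu>. u y * indicator {..x} y)"
      by (simp add: F_def)
    also have "(LINT y|\<mu>. u y * indicator {..x} y) = (LINT y:{0..x}|\<mu>. u y)"
      unfolding set_lebesgue_integral_def
      by (intro Bochner_Integration.integral_cong) (auto simp: space_mu indicator_def)
    also have "\<dots> = g' x - g' 0"
      using has_measure_derivativeD(3)[OF u True] by simp
    finally show ?thesis
      using True by (simp add: H_def)
  qed (simp add: F_def H_def)
  have inner_leb: "(LINT x|lborel. F x y) = u y * (h 1 - h y)" if y: "y \<in> {0..1}" for y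
  proof -
    have "(LINT x|lborel. F x y) = (LINT x|lborel. u y * (indicator {y..1} x *\<^sub>R h' x))"
      using y by (intro Bochner_Integration.integral_cong) (auto simp: F_def H_def indicator_def)
    also have "\<dots> = u y * (LINT x:{y..1}|lborel. h' x)"
      by (simp add: set_lebesgue_integral_def)
    also have "(LINT x:{y..1}|lborel. h' x) = integral {y..1} h'"
      using y by (intro set_borel_integral_eq_integral borel_integrable_atLeastAtMost'
          continuous_on_subset[OF cont(2)]) auto
    also have "\<dots> = h 1 - h y"
      using C1_pair_integral[OF h, of y 1] y by (auto intro: integral_unique)
    finally show ?thesis .
  qed
  have cont_hg: "continuous_on {0..1} (\<lambda>x. h' x * (g' x - g' 0))"
    using cont g by (intro continuous_intros)
  have int_g': "(LINT y|\<mu>. u y) = g' 1 - g' 0"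
  proof -
    have "(LINT y|\<mu>. u y) = (LINT y:{0..1}|\<mu>. u y)"
      unfolding set_lebesgue_integral_def
      by (intro Bochner_Integration.integral_cong) (auto simp: space_mu indicator_def)
    also have "\<dots> = g' 1 - g' 0"
      using has_measure_derivativeD(3)[OF u, of 1] by simp
    finally show ?thesis .
  qed
  have int_hu: "integrable \<mu> (\<lambda>y. h y * u y)"
  proof -
    have "integrable \<mu> (\<lambda>y. (h y)\<^sup>2)" "integrable \<mu> h"
      using cont by (auto intro!: continuous_integrable continuous_intros)
    then have "sq_integrable \<mu> h" "sq_integrable \<mu> u"
      using has_measure_derivativeD(1)[OF u] by (auto simp: sq_integrable_def)
    then have i: "integrable \<mu> (\<lambda>y. (h y)\<^sup>2 + (u y)\<^sup>2)" and [measurable]: "h \<in> borel_measurable \<mu>"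
      by (auto simp: sq_integrable_def)
    have "\<bar>h y * u y\<bar> \<le> (h y)\<^sup>2 + (u y)\<^sup>2" for y
    proof -
      have "2 * \<bar>h y * u y\<bar> \<le> (h y)\<^sup>2 + (u y)\<^sup>2"
        using zero_le_power2[of "\<bar>h y\<bar> - \<bar>u y\<bar>"] by (simp add: power2_diff abs_mult)
      then show ?thesis
        using abs_ge_zero[of "h y * u y"] by linarith
    qed
    then show ?thesis
      by (intro Bochner_Integration.integrable_bound[OF i]) (auto intro: AE_I2)
  qed
  have "integral {0..1} (\<lambda>x. h' x * (g' x - g' 0)) = (LINT x|lborel. (LINT y|\<mu>. F x y))"
    using set_borel_integral_eq_integral(2)[OF borel_integrable_atLeastAtMost'[OF cont_hg]]
    by (simp add: inner_mu set_lebesgue_integral_def)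
  also have "\<dots> = (LINT y|\<mu>. (LINT x|lborel. F x y))"
    using Fubini_integral[OF intF] by simp
  also have "\<dots> = (LINT y|\<mu>. h 1 * u y - h y * u y)"
    by (intro Bochner_Integration.integral_cong) (auto simp: space_mu inner_leb algebra_simps)
  also have "\<dots> = h 1 * (g' 1 - g' 0) - (LINT y|\<mu>. h y * u y)"
    using int_hu intu int_g' by simp
  finally have 1: "integral {0..1} (\<lambda>x. h' x * (g' x - g' 0)) =
      h 1 * (g' 1 - g' 0) - (LINT y|\<mu>. h y * u y)" .
  have "(\<lambda>x. h' x * (g' x - g' 0)) integrable_on {0..1}"
    using cont_hg by (rule integrable_continuous_interval)
  then have "((\<lambda>x. h' x * (g' x - g' 0) + g' 0 * h' x) has_integral
      (h 1 * (g' 1 - g' 0) - (LINT y|\<mu>. h y * u y)) + g' 0 * (h 1 - h 0)) {0..1}"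
    using C1_pair_integral[OF h, of 0 1] 1
    by (intro has_integral_add has_integral_mult_right) (auto simp: has_integral_iff)
  then show ?thesis
    by (intro integral_unique) (simp add: algebra_simps)
qed

end

section \<open>Linear combinations\<close>

lemma C1_pair_lincomb:
  assumes "C1_pair f f'" "C1_pair g g'"
  shows "C1_pair (\<lambda>x. f x + c * g x) (\<lambda>x. f' x + c * g' x)"
  using assms unfolding C1_pair_def
  by (auto intro!: continuous_intros DERIV_add DERIV_cmult)

context unit_prob
begin

lemma sq_integrable_lincomb:
  assumes u: "sq_integrable \<mu> u" and w: "sq_integrable \<mu> w"
  shows "sq_integrable \<mu> (\<lambda>x. u x + c * w x)"
proof -
  have [measurable]: "u \<in> borel_measurable \<mu>" "w \<in> borel_measurable \<mu>"
    using u w by (auto simp: sq_integrable_def)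
  have int: "integrable \<mu> (\<lambda>x. 2 * (u x)\<^sup>2 + 2 * c\<^sup>2 * (w x)\<^sup>2)"
    using u w by (auto simp: sq_integrable_def)
  have "(u x + c * w x)\<^sup>2 \<le> 2 * (u x)\<^sup>2 + 2 * c\<^sup>2 * (w x)\<^sup>2" for x
    using zero_le_power2[of "u x - c * w x"] by (simp add: power2_eq_square algebra_simps)
  then have "integrable \<mu> (\<lambda>x. (u x + c * w x)\<^sup>2)"
    by (intro Bochner_Integration.integrable_bound[OF int]) (auto intro: AE_I2)
  then show ?thesis
    by (simp add: sq_integrable_def)
qed

lemma has_measure_derivative_lincomb:
  assumes f: "has_measure_derivative \<mu> f u" and g: "has_measure_derivative \<mu> g w"
  shows "has_measure_derivative \<mu> (\<lambda>x. f x + c * g x) (\<lambda>x. u x + c * w x)"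
  unfolding has_measure_derivative_def
proof (intro conjI ballI)
  show "sq_integrable \<mu> (\<lambda>x. u x + c * w x)"
    using f g by (intro sq_integrable_lincomb has_measure_derivativeD)
  fix x :: real assume x: "x \<in> {0..1}"
  have int: "set_integrable \<mu> {0..x} u" "set_integrable \<mu> {0..x} w"
    unfolding set_integrable_def
    using has_measure_derivativeD(2)[OF f] has_measure_derivativeD(2)[OF g] x
    by (auto intro!: integrable_mult_indicator sets_muI simp del: real_scaleR_def)
  then have "(LINT y:{0..x}|\<mu>. u y + c * w y) = (LINT y:{0..x}|\<mu>. u y) + c * (LINT y:{0..x}|\<mu>. w y)"
    by (subst set_integral_add) auto
  then show "f x + c * g x = f 0 + c * g 0 + (LINT y:{0..x}|\<mu>. u y + c * w y)"
    using has_measure_derivativeD(3)[OF f x] has_measure_derivativeD(3)[OF g x]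
    by (simp add: algebra_simps)
qed

text \<open>\<open>f\<close> belongs to \<open>\<D>\<^sub>\<mu>\<^sup>2\<close> with derivative \<open>f'\<close> and \<open>\<Delta>\<^sub>\<mu> f = u\<close>.\<close>

definition D2_triple :: "(real \<Rightarrow> real) \<Rightarrow> (real \<Rightarrow> real) \<Rightarrow> (real \<Rightarrow> real) \<Rightarrow> bool" where
  "D2_triple f f' u \<longleftrightarrow> C1_pair f f' \<and> has_measure_derivative \<mu> f' u"

lemma D2_triple_lincomb:
  "D2_triple f f' u \<Longrightarrow> D2_triple g g' w \<Longrightarrow>
    D2_triple (\<lambda>x. f x + c * g x) (\<lambda>x. f' x + c * g' x) (\<lambda>x. u x + c * w x)"
  by (simp add: D2_triple_def C1_pair_lincomb has_measure_derivative_lincomb)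

lemma D2_triple_zero: "D2_triple (\<lambda>x. 0) (\<lambda>x. 0) (\<lambda>x. 0)"
  by (auto simp: D2_triple_def C1_pair_def has_measure_derivative_def sq_integrable_def
      set_lebesgue_integral_def)

lemma D2_triple_sum:
  fixes n :: nat
  assumes "\<And>k. D2_triple (f k) (f' k) (u k)"
  shows "D2_triple (\<lambda>x. \<Sum>k<n. c k * f k x) (\<lambda>x. \<Sum>k<n. c k * f' k x) (\<lambda>x. \<Sum>k<n. c k * u k x)"
  using D2_triple_lincomb[OF _ assms] by (induction n) (auto simp: D2_triple_zero)

lemma D2_triple_deriv01: "h \<in> D2 \<mu> \<Longrightarrow> \<exists>u. D2_triple h (deriv01 h) u"
  by (auto simp: D2_def D2_triple_def C1_pair_deriv01)

end

section \<open>The exponent\<close>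

locale weighted_ifs =
  fixes N :: nat and r b m :: "nat \<Rightarrow> real"
  assumes ifs: "affine_ifs N r b" and weights: "probability_weights N m"
begin

abbreviation S :: "nat \<Rightarrow> real \<Rightarrow> real" where
  "S \<equiv> affine_map r b"

lemma N_ge_2: "2 \<le> N"
  using ifs by (simp add: affine_ifs_def)

lemma ratio: "i \<in> {1..N} \<Longrightarrow> 0 < r i" "i \<in> {1..N} \<Longrightarrow> r i < 1"
  using ifs by (auto simp: affine_ifs_def)

lemma weight: "i \<in> {1..N} \<Longrightarrow> 0 < m i" "i \<in> {1..N} \<Longrightarrow> m i < 1"
  using weights by (auto simp: probability_weights_def)

lemma weighted_ratio:
  assumes "i \<in> {1..N}"
  shows "0 < m i * r i" "m i * r i < m i" "m i * r i < 1"
proof -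
  show "0 < m i * r i" "m i * r i < m i"
    using ratio[OF assms] weight[OF assms] by auto
  then show "m i * r i < 1"
    using weight[OF assms] by linarith
qed

text \<open>The sum of the \<open>(m i * r i) powr g\<close> decreases strictly in \<open>g\<close>, is \<open>N > 1\<close> at \<open>0\<close> and less than
  \<open>1\<close> at \<open>1\<close>; so the defining equation has exactly one solution, and it lies to the right of \<open>0\<close>.\<close>

lemma spectral_exponent_pos: "0 < spectral_exponent N r m"
proof -
  let ?f = "\<lambda>g::real. \<Sum>i=1..N. (m i * r i) powr g"
  have ne: "{1..N} \<noteq> {}" "finite {1..N}"
    using N_ge_2 by auto
  have decreasing: "?f g' < ?f g" if "g < g'" for g g'
    using that weighted_ratio ne by (intro sum_strict_mono powr_less_mono') auto
  have at_0: "?f 0 = real N"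
  proof -
    have "(m i * r i) powr 0 = 1" if "i \<in> {1..N}" for i
      using weighted_ratio(1)[OF that] by (metis less_irrefl powr_zero_eq_one)
    then have "?f 0 = (\<Sum>i=1..N. 1)"
      by (rule sum.cong[OF refl])
    then show ?thesis
      by simp
  qed
  have at_1: "?f 1 < 1"
  proof -
    have "?f 1 = (\<Sum>i=1..N. m i * r i)"
      using weighted_ratio by (intro sum.cong) (auto simp: less_imp_le powr_one)
    also have "\<dots> < (\<Sum>i=1..N. m i)"
      using weighted_ratio ne by (intro sum_strict_mono) auto
    also have "\<dots> = 1"
      using weights by (simp add: probability_weights_def)
    finally show ?thesis .
  qed
  have "\<exists>g\<ge>0. g \<le> 1 \<and> ?f g = 1"
  proof (rule IVT2')
    show "continuous_on {0..1} ?f"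
      using weighted_ratio(1) by (intro continuous_intros) (metis less_irrefl)
  qed (use at_0 at_1 N_ge_2 in auto)
  then obtain g where g: "?f g = 1"
    by blast
  have unique: "g' = g" if "?f g' = 1" for g'
    using decreasing[of g g'] decreasing[of g' g] that g by (cases g g' rule: linorder_cases) auto
  have "spectral_exponent N r m = g"
    unfolding spectral_exponent_def using g unique by (rule the_equality)
  moreover have "0 < g"
  proof (rule ccontr)
    assume "\<not> 0 < g"
    then have "?f 0 \<le> ?f g"
      using decreasing[of g 0] by (cases "g = 0") auto
    then show False
      using at_0 g N_ge_2 by simp
  qed
  ultimately show ?thesis
    by simp
qed

text \<open>The exponent \<open>\<gamma> \<delta>\<close>, written without the spectral exponent.\<close>

definition \<theta> :: real where
  "\<theta> = Max ((\<lambda>i. ln (m i) / ln (m i * r i)) ` {1..N})"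

text \<open>Since \<open>ln (x powr \<gamma>) = \<gamma> ln x\<close>, the factor \<open>\<gamma> > 0\<close> can be moved inside the maximum, where it cancels.\<close>

lemma spectral_exponent_times_delta:
  "spectral_exponent N r m * spectral_delta N r m = \<theta>"
proof -
  let ?g = "spectral_exponent N r m"
  let ?q = "\<lambda>i. ln (m i) / ln ((m i * r i) powr ?g)"
  have ne: "{1..N} \<noteq> {}" "finite {1..N}"
    using N_ge_2 by auto
  have "?g * Max (?q ` {1..N}) = Max ((\<lambda>x. ?g * x) ` ?q ` {1..N})"
    using ne spectral_exponent_pos
    by (intro mono_Max_commute) (auto simp: mono_def mult_left_mono)
  also have "(\<lambda>x. ?g * x) ` ?q ` {1..N} = (\<lambda>i. ln (m i) / ln (m i * r i)) ` {1..N}"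
    using spectral_exponent_pos by (auto simp: image_image ln_powr intro!: image_cong)
  finally show ?thesis
    by (simp add: spectral_delta_def \<theta>_def)
qed

lemma theta_range: "0 < \<theta>" "\<theta> < 1"
proof -
  have ne: "{1..N} \<noteq> {}" "finite {1..N}"
    using N_ge_2 by auto
  have range: "0 < ln (m i) / ln (m i * r i) \<and> ln (m i) / ln (m i * r i) < 1" if "i \<in> {1..N}" for i
  proof -
    have "ln (m i * r i) < ln (m i)" "ln (m i) < 0"
      using weight[OF that] weighted_ratio[OF that] by auto
    then show ?thesis
      by (auto simp: divide_neg_neg divide_less_eq)
  qed
  have "\<theta> \<in> (\<lambda>i. ln (m i) / ln (m i * r i)) ` {1..N}"
    unfolding \<theta>_def using ne by (intro Max_in) auto
  then show "0 < \<theta>" "\<theta> < 1"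
    using range by auto
qed

text \<open>What the maximum in \<open>\<delta>\<close> is for: passing to a subcell multiplies the weight by \<open>m i\<close> and weight
  times length by \<open>m i * r i\<close>, so a lower bound of the weight by the power \<open>\<theta>\<close> of weight times
  length survives every subdivision.\<close>

lemma weighted_ratio_powr_le:
  assumes "i \<in> {1..N}"
  shows "(m i * r i) powr \<theta> \<le> m i"
proof -
  have "ln (m i) / ln (m i * r i) \<le> \<theta>"
    unfolding \<theta>_def using assms by (intro Max_ge) auto
  moreover have "ln (m i * r i) < 0"
    using weighted_ratio[OF assms] by simp
  ultimately have "\<theta> * ln (m i * r i) \<le> ln (m i)"
    by (simp add: divide_le_eq mult.commute)
  then have "exp (\<theta> * ln (m i * r i)) \<le> exp (ln (m i))"
    by simp
  then show ?thesis
    using weight[OF assms] weighted_ratio[OF assms] by (auto simp: powr_def)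
qed

section \<open>Cells and gaps of a self-similar measure\<close>

lemma map_mono: "i \<in> {1..N} \<Longrightarrow> S i x \<le> S i y \<longleftrightarrow> x \<le> y"
  using ratio[of i] by (simp add: affine_map_def)

lemma map_strict_mono: "i \<in> {1..N} \<Longrightarrow> S i x < S i y \<longleftrightarrow> x < y"
  using ratio[of i] by (simp add: affine_map_def)

lemma map_range: "i \<in> {1..N} \<Longrightarrow> 0 \<le> S i 0 \<and> S i 1 \<le> 1"
  using ifs by (force simp: affine_ifs_def affine_map_def)

lemma map_in_unit:
  assumes "i \<in> {1..N}" "x \<in> {0..1}"
  shows "0 \<le> S i x" "S i x \<le> 1"
  using map_range[OF assms(1)] map_mono[OF assms(1), of 0 x] map_mono[OF assms(1), of x 1] assms(2)
  by auto

lemma cells_ordered: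
  assumes "i \<in> {1..N}" "j \<in> {1..N}" "i < j"
  shows "S i 1 \<le> S j 0"
proof -
  have "S i 1 \<le> S (Suc i + k) 0" if "Suc i + k \<le> N" for k
    using that
  proof (induction k)
    case 0
    then show ?case
      using ifs assms(1) by (auto simp: affine_ifs_def)
  next
    case (Suc k)
    have "S (Suc i + k) 0 \<le> S (Suc i + k) 1"
      using Suc.prems by (subst map_mono) auto
    also have "\<dots> \<le> S (Suc i + Suc k) 0"
      using ifs Suc.prems by (auto simp: affine_ifs_def)
    finally show ?case
      using Suc by auto
  qed
  from this[of "j - Suc i"] show ?thesis
    using assms by simp
qed

text \<open>The relevant index is the last one whose cell begins at or before \<open>x\<close>.\<close>

lemma cell_or_gap:
  assumes "x \<in> {0..1}"
  obtains (cell) i z where "i \<in> {1..N}" "z \<in> {0..1}" "x = S i z"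
  | (gap) i where "i \<in> {1..<N}" "S i 1 < x" "x < S (Suc i) 0"
proof -
  define I where "I = {i \<in> {1..N}. S i 0 \<le> x}"
  define i where "i = Max I"
  have "1 \<in> I"
    using ifs assms by (auto simp: I_def affine_ifs_def)
  then have "i \<in> I"
    unfolding i_def by (intro Max_in) (auto simp: I_def)
  then have i: "i \<in> {1..N}" "S i 0 \<le> x"
    by (auto simp: I_def)
  show thesis
  proof (cases "x \<le> S i 1")
    case True
    define z where "z = (x - b i) / r i"
    have "x = S i z"
      using ratio[OF i(1)] by (simp add: z_def affine_map_def)
    moreover have "z \<in> {0..1}"
      using i True map_mono[OF i(1)] \<open>x = S i z\<close> by auto
    ultimately show thesis
      using cell i(1) by blast
  next
    case False
    have "i \<noteq> N"
      using False ifs assms by (auto simp: affine_ifs_def)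
    then have "i \<in> {1..<N}"
      using i by auto
    moreover have "Suc i \<notin> I"
    proof
      assume "Suc i \<in> I"
      then have "Suc i \<le> i"
        unfolding i_def by (intro Max_ge) (auto simp: I_def)
      then show False
        by simp
    qed
    ultimately show thesis
      using gap False by (auto simp: I_def)
  qed
qed

end

locale self_similar = weighted_ifs +
  fixes \<mu> :: "real measure"
  assumes self_similar: "self_similar_measure N r b m \<mu>"
begin

sublocale unit_prob \<mu>
  using self_similar
  by (auto simp: self_similar_measure_def intro!: unit_prob.intro unit_prob_axioms.intro)

lemma measure_split:
  assumes "A \<in> sets borel" "A \<subseteq> {0..1}"
  shows "measure \<mu> A = (\<Sum>i=1..N. m i * measure \<mu> (S i -` A \<inter> {0..1}))"
  using self_similar sets_muI[OF assms] by (auto simp: self_similar_measure_def)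

text \<open>Only an inequality: if two cells touch, the common end point may lie in both, and then the other
  terms of the self-similarity identity can contribute as well.\<close>

lemma measure_cell_ge:
  assumes i: "i \<in> {1..N}" and "0 \<le> u" "v \<le> 1"
  shows "m i * measure \<mu> {u..v} \<le> measure \<mu> {S i u..S i v}"
proof (cases "u \<le> v")
  case True
  have "{S i u..S i v} \<subseteq> {0..1}"
    using map_in_unit[OF i, of u] map_in_unit[OF i, of v] assms True by auto
  moreover have "S i -` {S i u..S i v} \<inter> {0..1} = {u..v}"
    using assms True map_mono[OF i] by auto
  moreover have "m i * measure \<mu> (S i -` {S i u..S i v} \<inter> {0..1}) \<le>
      (\<Sum>j=1..N. m j * measure \<mu> (S j -` {S i u..S i v} \<inter> {0..1}))"
    using i weight by (intro member_le_sum) (auto simp: less_imp_le)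
  ultimately show ?thesis
    by (subst measure_split) auto
qed (use i weight in auto)

text \<open>For open intervals there is no such contribution, because an open subinterval of one cell does
  not meet any other cell.\<close>

lemma null_image:
  assumes i: "i \<in> {1..N}" and "0 \<le> u" "v \<le> 1" and null: "measure \<mu> {u<..<v} = 0"
  shows "measure \<mu> {S i u<..<S i v} = 0"
proof (cases "u < v")
  case True
  have "measure \<mu> (S j -` {S i u<..<S i v} \<inter> {0..1}) = 0" if j: "j \<in> {1..N}" for j
  proof (cases "j = i")
    case True
    then have "S j -` {S i u<..<S i v} \<inter> {0..1} = {u<..<v}"
      using assms map_strict_mono[OF i] by auto
    then show ?thesis
      using null by simp
  next
    case False
    have "S i 0 \<le> S i u" "S i v \<le> S i 1"
      using map_mono[OF i] assms by auto
    moreover have "S j 0 \<le> S j y" "S j y \<le> S j 1" if "y \<in> {0..1}" for y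
      using map_mono[OF j] that by auto
    moreover have "S i 1 \<le> S j 0 \<or> S j 1 \<le> S i 0"
      using cells_ordered i j False by (meson linorder_neqE_nat)
    ultimately have "S j -` {S i u<..<S i v} \<inter> {0..1} = {}"
      by fastforce
    then show ?thesis
      by (metis measure_empty)
  qed
  moreover have "{S i u<..<S i v} \<subseteq> {0..1}"
    using map_in_unit[OF i, of u] map_in_unit[OF i, of v] assms True by auto
  ultimately show ?thesis
    by (subst measure_split) (auto intro!: sum.neutral)
next
  case False
  then have "S i v \<le> S i u"
    using map_mono[OF i] by simp
  then show ?thesis
    by simp
qed

lemma null_gap:
  assumes i: "i \<in> {1..<N}"
  shows "measure \<mu> {S i 1<..<S (Suc i) 0} = 0"
proof -
  have empty: "S j -` {S i 1<..<S (Suc i) 0} \<inter> {0..1} = {}" if j: "j \<in> {1..N}" for j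
  proof -
    have "S j 1 \<le> S i 1 \<or> S (Suc i) 0 \<le> S j 0"
    proof (cases i j rule: linorder_cases)
      case less
      then show ?thesis
        using cells_ordered[of "Suc i" j] map_mono[of "Suc i" 0 1] i j by (cases "j = Suc i") auto
    next
      case greater
      then have "S j 1 \<le> S i 0" "S i 0 \<le> S i 1"
        using cells_ordered[of j i] map_mono[of i 0 1] i j by auto
      then show ?thesis
        by auto
    qed auto
    moreover have "S j 0 \<le> S j y" "S j y \<le> S j 1" if "y \<in> {0..1}" for y
      using map_mono[OF j] that by auto
    ultimately show ?thesis
      by fastforce
  qed
  have "{S i 1<..<S (Suc i) 0} \<subseteq> {0..1}"
    using map_range[of i] map_range[of "Suc i"] map_in_unit[of i 1] map_in_unit[of "Suc i" 0] i
    by auto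
  then show ?thesis
    by (subst measure_split) (auto simp: empty intro!: sum.neutral)
qed

definition min_scale :: real where
  "min_scale = Min ((\<lambda>i. m i * r i) ` {1..N})"

lemma min_scale_le: "i \<in> {1..N} \<Longrightarrow> min_scale \<le> m i * r i"
  unfolding min_scale_def by (intro Min_le) auto

lemma min_scale_range: "0 < min_scale" "min_scale < 1"
proof -
  have "min_scale \<in> (\<lambda>i. m i * r i) ` {1..N}"
    unfolding min_scale_def using N_ge_2 by (intro Min_in) auto
  then show "0 < min_scale" "min_scale < 1"
    using weighted_ratio by auto
qed

text \<open>The point \<open>y\<close> lies in an interval that is heavy and short enough for the Sobolev inequality at
  scale \<open>t\<close>. The interval stands for a cell whose weight times length is between
  \<open>t\<close> and \<open>t / min_scale\<close>; formulating the condition by its mass and length avoids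
  the bookkeeping of words in the maps.\<close>

definition charged :: "real \<Rightarrow> real \<Rightarrow> bool" where
  "charged t y \<longleftrightarrow> (\<exists>u v. 0 \<le> u \<and> u \<le> y \<and> y \<le> v \<and> v \<le> 1 \<and>
     t powr \<theta> \<le> measure \<mu> {u..v} \<and> t powr \<theta> * (v - u) \<le> t / min_scale)"

lemma charged_coarse:
  assumes "min_scale < t" "t \<le> 1" "y \<in> {0..1}"
  shows "charged t y"
proof -
  have "t powr \<theta> \<le> 1"
    using assms min_scale_range theta_range by (intro powr_le1) auto
  moreover have "measure \<mu> {0..1} = 1"
    using prob_space space_mu by simp
  moreover have "1 \<le> t / min_scale"
    using assms min_scale_range by simp
  ultimately show ?thesis
    unfolding charged_def using assms by (intro exI[of _ 0] exI[of _ 1]) auto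
qed

text \<open>The image of an interval for the scale \<open>t / (m i * r i)\<close> serves at scale \<open>t\<close>: writing
  \<open>w = m i * r i\<close> and \<open>t powr \<theta> = w powr \<theta> * (t / w) powr \<theta>\<close>, both conditions reduce to
  \<open>w powr \<theta> \<le> m i\<close>.\<close>

lemma charged_image:
  assumes i: "i \<in> {1..N}" and "0 < t" and "charged (t / (m i * r i)) y"
  shows "charged t (S i y)"
proof -
  define w where "w = m i * r i"
  have w: "0 < w" "w powr \<theta> \<le> m i"
    using weighted_ratio[OF i] weighted_ratio_powr_le[OF i] by (auto simp: w_def)
  obtain u v where uv: "0 \<le> u" "u \<le> y" "y \<le> v" "v \<le> 1"
    "(t / w) powr \<theta> \<le> measure \<mu> {u..v}" "(t / w) powr \<theta> * (v - u) \<le> t / w / min_scale"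
    using assms(3) by (auto simp: charged_def w_def)
  have eq: "t powr \<theta> = w powr \<theta> * (t / w) powr \<theta>"
    using \<open>0 < t\<close> w by (simp flip: powr_mult)
  have "t powr \<theta> \<le> m i * measure \<mu> {u..v}"
    unfolding eq using uv w weight[OF i] by (intro mult_mono) auto
  also have "\<dots> \<le> measure \<mu> {S i u..S i v}"
    using i uv by (intro measure_cell_ge) auto
  finally have "t powr \<theta> \<le> measure \<mu> {S i u..S i v}" .
  moreover have "t powr \<theta> * (S i v - S i u) \<le> t / min_scale"
  proof -
    have "t powr \<theta> * (S i v - S i u) = (w powr \<theta> * r i) * ((t / w) powr \<theta> * (v - u))"
      by (simp add: eq affine_map_def algebra_simps)
    also have "\<dots> \<le> (m i * r i) * (t / w / min_scale)"
      using uv w ratio[OF i] weight[OF i] by (intro mult_mono) (auto intro!: mult_nonneg_nonneg)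
    also have "\<dots> = t / min_scale"
      using w(1) unfolding w_def[symmetric] by simp
    finally show ?thesis .
  qed
  moreover have "0 \<le> S i u" "S i u \<le> S i y" "S i y \<le> S i v" "S i v \<le> 1"
    using map_mono[OF i] map_in_unit[OF i, of u] map_in_unit[OF i, of v] uv by auto
  ultimately show ?thesis
    unfolding charged_def by blast
qed

text \<open>Descend through the cells that contain \<open>x\<close>, increasing the scale until it exceeds \<open>min_scale\<close>,
  where the whole unit interval will do. If \<open>x\<close> falls into a gap on the way, the ends of
  the gap are images of \<open>0\<close> and \<open>1\<close>. These are charged at every scale: in
  the induction hypothesis for \<open>x = 0\<close> the left point must be \<open>0\<close>, and for \<open>x = 1\<close> the right point
  must be \<open>1\<close>.\<close>

lemma between_charged:
  assumes "0 < t" "t \<le> 1" "x \<in> {0..1}"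
  shows "\<exists>a c. 0 \<le> a \<and> a \<le> x \<and> x \<le> c \<and> c \<le> 1 \<and> charged t a \<and> charged t c \<and>
    measure \<mu> {a<..<c} = 0"
proof -
  \<comment> \<open>One step divides the scale by at most \<open>Q < 1\<close>, so finitely many steps suffice.\<close>
  define Q where "Q = Max ((\<lambda>i. m i * r i) ` {1..N})"
  have Q_ge: "m i * r i \<le> Q" if "i \<in> {1..N}" for i
    unfolding Q_def using that by (intro Max_ge) auto
  have "Q \<in> (\<lambda>i. m i * r i) ` {1..N}"
    unfolding Q_def using N_ge_2 by (intro Max_in) auto
  then have Q: "0 < Q" "Q < 1"
    using weighted_ratio by auto
  have main: "\<exists>a c. 0 \<le> a \<and> a \<le> x \<and> x \<le> c \<and> c \<le> 1 \<and> charged t a \<and> charged t c \<and>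
      measure \<mu> {a<..<c} = 0"
    if "Q ^ n < t" "t \<le> 1" "x \<in> {0..1}" for n t x
    using that
  proof (induction n arbitrary: t x)
    case 0
    then show ?case
      by simp
  next
    case (Suc n)
    have t: "0 < t"
      using Suc.prems(1) Q by (meson less_trans zero_less_power)
    show ?case
    proof (cases "min_scale < t")
      case True
      then have "charged t x"
        using Suc.prems by (intro charged_coarse) auto
      then show ?thesis
        using Suc.prems(3) by (intro exI[of _ x]) auto
    next
      case False
      have IH: "\<exists>a c. 0 \<le> a \<and> a \<le> z \<and> z \<le> c \<and> c \<le> 1 \<and> charged (t / (m i * r i)) a \<and>
          charged (t / (m i * r i)) c \<and> measure \<mu> {a<..<c} = 0"
        if "i \<in> {1..N}" "z \<in> {0..1}" for i z
      proof (rule Suc.IH)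
        have "Q ^ n * (m i * r i) \<le> Q ^ n * Q"
          using Q Q_ge that by (intro mult_left_mono) auto
        then show "Q ^ n < t / (m i * r i)"
          using Suc.prems(1) weighted_ratio[OF that(1)] by (simp add: less_divide_eq mult.commute)
        show "t / (m i * r i) \<le> 1"
          using False min_scale_le[OF that(1)] weighted_ratio[OF that(1)] by (simp add: divide_le_eq)
      qed (use that in auto)
      show ?thesis
        using \<open>x \<in> {0..1}\<close>
      proof (cases rule: cell_or_gap)
        case (cell i z)
        obtain a c where ac: "0 \<le> a" "a \<le> z" "z \<le> c" "c \<le> 1" "charged (t / (m i * r i)) a"
          "charged (t / (m i * r i)) c" "measure \<mu> {a<..<c} = 0"
          using IH[OF cell(1,2)] by blast
        show ?thesis
          using ac cell map_mono[OF cell(1)] charged_image[OF cell(1) t] null_image[OF cell(1)]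
            map_in_unit[OF cell(1), of a] map_in_unit[OF cell(1), of c]
          by (intro exI[of _ "S i a"] exI[of _ "S i c"]) auto
      next
        case (gap i)
        have i: "i \<in> {1..N}" "Suc i \<in> {1..N}"
          using gap(1) by auto
        have "charged t (S i 1)"
          using IH[OF i(1), of 1] by (intro charged_image[OF i(1) t]) (auto dest: antisym)
        moreover have "charged t (S (Suc i) 0)"
          using IH[OF i(2), of 0] by (intro charged_image[OF i(2) t]) (auto dest: antisym)
        ultimately show ?thesis
          using gap null_gap[OF gap(1)] map_in_unit[OF i(1), of 1] map_in_unit[OF i(2), of 0]
          by (intro exI[of _ "S i 1"] exI[of _ "S (Suc i) 0"]) auto
      qed
    qed
  qed
  obtain n where "Q ^ n < t"
    using real_arch_pow_inv[OF \<open>0 < t\<close> Q(2)] by blast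
  then show ?thesis
    using main assms by blast
qed

end

section \<open>The Sobolev inequality\<close>

context self_similar
begin

lemma charged_square_le:
  assumes f: "C1_pair f f'" and t: "0 < t" and x: "charged t x"
  shows "t powr \<theta> * (f x)\<^sup>2 \<le> 2 / min_scale * ((LINT y|\<mu>. (f y)\<^sup>2) + t * energy f')"
proof -
  obtain u v where uv: "0 \<le> u" "u \<le> x" "x \<le> v" "v \<le> 1"
    "t powr \<theta> \<le> measure \<mu> {u..v}" "t powr \<theta> * (v - u) \<le> t / min_scale"
    using x by (auto simp: charged_def)
  define M P I E where "M = measure \<mu> {u..v}" and "P = t powr \<theta>"
    and "I = (LINT y|\<mu>. (f y)\<^sup>2)" and "E = energy f'"
  have nonneg: "0 \<le> I" "0 \<le> E" "0 < P" "P \<le> M"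
    using energy_nonneg t uv by (auto simp: I_def E_def P_def M_def)
  have *: "((f x)\<^sup>2 - 2 * (v - u) * E) * M \<le> 2 * I"
    using square_times_mass_le[OF f uv(1-4)] by (simp add: M_def I_def E_def algebra_simps)
  \<comment> \<open>The mass \<open>M\<close> may be replaced by its lower bound \<open>P\<close>, whatever the sign of the first factor.\<close>
  have "((f x)\<^sup>2 - 2 * (v - u) * E) * P \<le> 2 * I"
  proof (cases "0 \<le> (f x)\<^sup>2 - 2 * (v - u) * E")
    case True
    then show ?thesis
      using * nonneg(4) by (meson mult_left_mono order_trans)
  next
    case False
    then have "((f x)\<^sup>2 - 2 * (v - u) * E) * P \<le> 0"
      using nonneg by (intro mult_nonpos_nonneg) auto
    then show ?thesis
      using nonneg by simp
  qed
  then have "P * (f x)\<^sup>2 \<le> 2 * I + 2 * (P * (v - u)) * E"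
    by (simp add: algebra_simps)
  also have "\<dots> \<le> 2 * I + 2 * (t / min_scale) * E"
    using uv nonneg by (intro add_mono mult_right_mono) (auto simp: P_def)
  also have "\<dots> \<le> 2 / min_scale * (I + t * E)"
  proof -
    have "I \<le> I / min_scale"
      using nonneg(1) min_scale_range mult_left_mono[of min_scale 1 I] by (simp add: pos_le_divide_eq)
    moreover have "2 / min_scale * (I + t * E) = 2 * (I / min_scale) + 2 * (t / min_scale) * E"
      by (simp add: algebra_simps add_divide_distrib)
    ultimately show ?thesis
      by linarith
  qed
  finally show ?thesis
    by (simp add: P_def I_def E_def)
qed

text \<open>At charged points this is the local inequality; any other point lies in a null interval with
  charged ends, where the function takes its largest modulus at an end.\<close>

lemma sobolev:
  assumes f: "D2_triple f f' u" and t: "0 < t" "t \<le> 1" and x: "x \<in> {0..1}"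
  shows "(f x)\<^sup>2 \<le> 2 / min_scale * t powr (- \<theta>) * ((LINT y|\<mu>. (f y)\<^sup>2) + t * energy f')"
proof -
  define B where "B = 2 / min_scale * ((LINT y|\<mu>. (f y)\<^sup>2) + t * energy f')"
  have f: "C1_pair f f'" "has_measure_derivative \<mu> f' u"
    using f by (auto simp: D2_triple_def)
  obtain a c where ac: "0 \<le> a" "a \<le> x" "x \<le> c" "c \<le> 1" "charged t a" "charged t c"
    "measure \<mu> {a<..<c} = 0"
    using between_charged[OF t x] by blast
  have "\<bar>f x\<bar> \<le> \<bar>f a\<bar> \<or> \<bar>f x\<bar> \<le> \<bar>f c\<bar>"
    using abs_le_on_null_interval[OF f ac(7,1-4)] by linarith
  then have "(f x)\<^sup>2 \<le> (f a)\<^sup>2 \<or> (f x)\<^sup>2 \<le> (f c)\<^sup>2"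
    by (simp add: abs_le_square_iff)
  then have "t powr \<theta> * (f x)\<^sup>2 \<le> t powr \<theta> * (f a)\<^sup>2 \<or> t powr \<theta> * (f x)\<^sup>2 \<le> t powr \<theta> * (f c)\<^sup>2"
    by (auto intro: mult_left_mono)
  then have "t powr \<theta> * (f x)\<^sup>2 \<le> B"
    using charged_square_le[OF f(1) t(1) ac(5)] charged_square_le[OF f(1) t(1) ac(6)]
    unfolding B_def by linarith
  then have "(f x)\<^sup>2 \<le> t powr (- \<theta>) * B"
    using t by (simp add: powr_minus field_simps)
  then show ?thesis
    unfolding B_def by (simp only: mult_ac)
qed

text \<open>Large times are reduced to the range \<open>t \<le> 1\<close> by applying the inequality at \<open>t / T\<close>.\<close>

lemma sobolev_upto:
  assumes f: "D2_triple f f' u" and T: "1 \<le> T" and t: "0 < t" "t \<le> T" and x: "x \<in> {0..1}"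
  shows "(f x)\<^sup>2 \<le> 2 / min_scale * T powr \<theta> * t powr (- \<theta>) * ((LINT y|\<mu>. (f y)\<^sup>2) + t * energy f')"
proof -
  have "(f x)\<^sup>2 \<le> 2 / min_scale * (t / T) powr (- \<theta>) * ((LINT y|\<mu>. (f y)\<^sup>2) + t / T * energy f')"
    using T t x by (intro sobolev[OF f]) auto
  also have "(t / T) powr (- \<theta>) = T powr \<theta> * t powr (- \<theta>)"
    using T t by (simp add: powr_divide powr_minus field_simps)
  also have "2 / min_scale * (T powr \<theta> * t powr (- \<theta>)) * ((LINT y|\<mu>. (f y)\<^sup>2) + t / T * energy f')
      \<le> 2 / min_scale * (T powr \<theta> * t powr (- \<theta>)) * ((LINT y|\<mu>. (f y)\<^sup>2) + t * energy f')"
    using T t min_scale_range energy_nonneg[of f'] mult_left_mono[of 1 T t]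
    by (intro mult_left_mono add_left_mono mult_right_mono) (auto simp: divide_le_eq)
  finally show ?thesis
    by (simp add: algebra_simps)
qed

text \<open>A class of \<open>L\<^sup>2\<close> has at most one representative in \<open>\<D>\<^sub>\<mu>\<^sup>2\<close>, gaps of the support included: for a
  difference \<open>d\<close> that vanishes almost everywhere the Sobolev inequality reads
  \<open>(d x)\<^sup>2 \<le> C t powr (1 - \<theta>)\<close>, and \<open>1 - \<theta> > 0\<close> as \<open>t\<close> tends to \<open>0\<close>.\<close>

lemma D2_eq_of_AE_eq:
  assumes f: "D2_triple f f' u" and g: "D2_triple g g' w" and ae: "AE y in \<mu>. f y = g y"
    and x: "x \<in> {0..1}"
  shows "f x = g x"
proof -
  define d d' where "d = (\<lambda>x. f x + (-1) * g x)" and "d' = (\<lambda>x. f' x + (-1) * g' x)"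
  have d: "D2_triple d d' (\<lambda>x. u x + (-1) * w x)"
    unfolding d_def d'_def using f g by (rule D2_triple_lincomb)
  have "(LINT y|\<mu>. (d y)\<^sup>2) = (LINT y|\<mu>. 0)"
  proof (rule integral_cong_AE)
    have "continuous_on {0..1} (\<lambda>y. (d y)\<^sup>2)"
      using d unfolding D2_triple_def by (intro continuous_intros C1_pairD(3)) auto
    then show "(\<lambda>y. (d y)\<^sup>2) \<in> borel_measurable \<mu>"
      using continuous_integrable by blast
    show "AE y in \<mu>. (d y)\<^sup>2 = 0"
      using ae by eventually_elim (simp add: d_def)
  qed simp
  then have bound: "(d x)\<^sup>2 \<le> 2 / min_scale * energy d' * t powr (1 - \<theta>)" if "0 < t" "t \<le> 1" for t
    using sobolev[OF d that x] that by (simp add: powr_diff powr_minus field_simps)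
  have "((\<lambda>t. 2 / min_scale * energy d' * t powr (1 - \<theta>)) \<longlongrightarrow> 2 / min_scale * energy d' * 0) (at_right 0)"
    using theta_range
    by (intro tendsto_mult_left tendsto_zero_powrI[where b = "1 - \<theta>"] tendsto_ident_at tendsto_const)
      (auto simp: eventually_at_right_less eventually_at_filter)
  moreover have "\<forall>\<^sub>F t in at_right 0. (d x)\<^sup>2 \<le> 2 / min_scale * energy d' * t powr (1 - \<theta>)"
    unfolding eventually_at_right_field using bound by (intro exI[of _ 1]) auto
  ultimately have "(d x)\<^sup>2 \<le> 2 / min_scale * energy d' * 0"
    by (intro tendsto_lowerbound) auto
  then show ?thesis
    by (simp add: d_def)
qed

end

section \<open>Elementary inequalities\<close>

lemma le_one_div_mult: "0 < t \<Longrightarrow> t * a \<le> b \<Longrightarrow> a \<le> 1 / t * (b::real)"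
  by (simp add: pos_le_divide_eq mult.commute)

lemma exp_minus_le_resolvent: "0 \<le> v \<Longrightarrow> exp (- v) \<le> 1 / (1 + v)" for v :: real
  using exp_ge_add_one_self[of v] by (simp add: exp_minus inverse_eq_divide frac_le)

text \<open>From \<open>1 + v / 2 \<le> exp (v / 2)\<close>, squared; the constant is not sharp.\<close>

lemma mult_exp_minus_le_resolvent:
  fixes v :: real
  assumes "0 \<le> v"
  shows "v * exp (- v) \<le> 4 * (1 / (1 + v))"
proof -
  have "v * (1 + v) \<le> 4 * ((1 + v / 2) * (1 + v / 2))"
    using assms by (simp add: algebra_simps)
  also have "\<dots> \<le> 4 * (exp (v / 2) * exp (v / 2))"
    using assms exp_ge_add_one_self[of "v / 2"] by (intro mult_left_mono mult_mono) auto
  also have "\<dots> = 4 * exp v"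
    by (simp flip: exp_add)
  finally have "v * (1 + v) * exp (- v) \<le> 4 * exp v * exp (- v)"
    by (rule mult_right_mono) simp
  also have "\<dots> = 4"
    by (simp flip: exp_add)
  finally have "v * exp (- v) * (1 + v) \<le> 4"
    by (simp only: mult_ac)
  then show ?thesis
    using assms by (simp add: pos_le_divide_eq)
qed

lemma mult_exp_minus_square_le_resolvent:
  fixes v :: real
  assumes "0 \<le> v"
  shows "v * (exp (- v))\<^sup>2 \<le> 1 / (1 + v)"
proof -
  have "v \<le> exp v"
    using exp_ge_add_one_self[of v] by linarith
  then have "v * exp (- v) \<le> 1"
    by (simp add: exp_minus divide_inverse[symmetric])
  then have "v * exp (- v) * exp (- v) \<le> 1 * (1 / (1 + v))"
    using assms exp_minus_le_resolvent[OF assms] by (intro mult_mono) auto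
  then show ?thesis
    by (simp add: power2_eq_square mult.assoc)
qed

lemma le_of_square_le_mult:
  fixes R B :: real
  assumes "R\<^sup>2 \<le> B * R" "0 \<le> R" "0 \<le> B"
  shows "R \<le> B"
  using assms by (cases "R = 0") (auto simp: power2_eq_square)

section \<open>Norm and energy of eigenfunction sums\<close>

lemma sum_diagonal:
  fixes c L :: "nat \<Rightarrow> real"
  shows "(\<Sum>j<n. \<Sum>k<n. c j * c k * (if j = k then L k else 0)) = (\<Sum>k<n. L k * (c k)\<^sup>2)"
  by (intro sum.cong refl)
    (simp add: if_distrib[of "\<lambda>x. _ * x"] sum.delta power2_eq_square algebra_simps cong: if_cong)

locale self_similar_eigenbasis = self_similar +
  fixes \<beta> :: boundary and \<Lambda> :: "nat \<Rightarrow> real" and \<phi> :: "nat \<Rightarrow> real \<Rightarrow> real"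
  assumes basis: "eigenbasis \<mu> \<beta> \<Lambda> \<phi>"
begin

lemma eigenvalue_nonneg: "0 \<le> \<Lambda> k"
  using basis monoD[of \<Lambda> 0 k] by (auto simp: eigenbasis_def)

lemma orthonormal: "(LINT y|\<mu>. \<phi> j y * \<phi> k y) = (if j = k then 1 else 0)"
  using basis by (auto simp: eigenbasis_def orthonormal_basis_def L2_inner_def)

lemma eigenfunction_D2: "\<exists>u. D2_triple (\<phi> k) (deriv01 (\<phi> k)) u"
  using basis D2_triple_deriv01 by (auto simp: eigenbasis_def)

lemma eigenfunction_C1: "C1_pair (\<phi> k) (deriv01 (\<phi> k))"
  using eigenfunction_D2 by (auto simp: D2_triple_def)

text \<open>The definition of an eigenfunction provides the equation and the boundary condition for some
  representative of the class; by uniqueness of the representative in \<open>\<D>\<^sub>\<mu>\<^sup>2\<close> it agrees with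
  \<open>\<phi> k\<close> on all of \<open>[0,1]\<close>, and so do the one-sided derivatives at the ends.\<close>

lemma eigenfunction_equation:
  obtains u where "D2_triple (\<phi> k) (deriv01 (\<phi> k)) u" "AE y in \<mu>. u y = - \<Lambda> k * \<phi> k y"
    "boundary_condition \<beta> (\<phi> k)"
proof -
  have "eigenfunction \<mu> \<beta> (\<Lambda> k) (\<phi> k)"
    using basis by (auto simp: eigenbasis_def)
  then obtain u h where h: "h \<in> D2 \<mu>" "AE y in \<mu>. \<phi> k y = h y" "boundary_condition \<beta> h"
    "has_measure_derivative \<mu> (deriv01 h) u" and u: "AE y in \<mu>. - u y = \<Lambda> k * \<phi> k y"
    unfolding eigenfunction_def laplacian_def by blast
  have triple: "D2_triple h (deriv01 h) u"
    using h D2_triple_deriv01 by (auto simp: D2_triple_def)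
  have eq: "\<phi> k x = h x" if "x \<in> {0..1}" for x
    using eigenfunction_D2[of k] D2_eq_of_AE_eq[OF _ triple h(2) that] by blast
  have deriv_eq: "deriv01 (\<phi> k) x = deriv01 h x" if "x \<in> {0..1}" for x
  proof (rule deriv01_eqI[OF _ that])
    have "(h has_real_derivative deriv01 h x) (at x within {0..1})"
      using triple that by (auto simp: D2_triple_def C1_pairD)
    then show "(\<phi> k has_real_derivative deriv01 h x) (at x within {0..1})"
      unfolding has_real_derivative_iff_has_vector_derivative
      using that eq by (rule has_vector_derivative_transform[rotated 2])
  qed
  have "has_measure_derivative \<mu> (deriv01 (\<phi> k)) u"
    unfolding has_measure_derivative_def
  proof (intro conjI ballI)
    fix x :: real assume "x \<in> {0..1}"
    then show "deriv01 (\<phi> k) x = deriv01 (\<phi> k) 0 + (LINT y:{0..x}|\<mu>. u y)"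
      using deriv_eq[of x] deriv_eq[of 0] has_measure_derivativeD(3)[OF h(4), of x] by simp
  qed (rule has_measure_derivativeD(1)[OF h(4)])
  then have "D2_triple (\<phi> k) (deriv01 (\<phi> k)) u"
    using eigenfunction_C1 by (simp add: D2_triple_def)
  moreover have "AE y in \<mu>. u y = - \<Lambda> k * \<phi> k y"
    using u by eventually_elim simp
  moreover have "boundary_condition \<beta> (\<phi> k)"
    using h(3) eq deriv_eq by (cases \<beta>) auto
  ultimately show thesis
    by (rule that)
qed

text \<open>Both boundary conditions make the boundary terms in Green's formula vanish: Neumann through the
  derivative of \<open>\<phi> k\<close>, Dirichlet through the values of \<open>\<phi> j\<close>.\<close>

lemma derivatives_orthogonal:
  "integral {0..1} (\<lambda>x. deriv01 (\<phi> j) x * deriv01 (\<phi> k) x) = (if j = k then \<Lambda> k else 0)"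
proof -
  obtain u where u: "D2_triple (\<phi> k) (deriv01 (\<phi> k)) u" "AE y in \<mu>. u y = - \<Lambda> k * \<phi> k y"
    "boundary_condition \<beta> (\<phi> k)"
    by (rule eigenfunction_equation)
  obtain w where w: "boundary_condition \<beta> (\<phi> j)"
    by (rule eigenfunction_equation)
  have "integral {0..1} (\<lambda>x. deriv01 (\<phi> j) x * deriv01 (\<phi> k) x) =
      deriv01 (\<phi> k) 1 * \<phi> j 1 - deriv01 (\<phi> k) 0 * \<phi> j 0 - (LINT y|\<mu>. \<phi> j y * u y)"
    using u(1)
    by (intro green_formula eigenfunction_C1 C1_pairD(2)[OF eigenfunction_C1]) (simp add: D2_triple_def)
  also have "deriv01 (\<phi> k) 1 * \<phi> j 1 - deriv01 (\<phi> k) 0 * \<phi> j 0 = 0"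
    using u(3) w by (cases \<beta>) auto
  also have "(LINT y|\<mu>. \<phi> j y * u y) = (LINT y|\<mu>. - \<Lambda> k * (\<phi> j y * \<phi> k y))"
  proof (rule integral_cong_AE)
    have [measurable]: "\<phi> i \<in> borel_measurable \<mu>" for i
      using basis by (auto simp: eigenbasis_def orthonormal_basis_def sq_integrable_def)
    have [measurable]: "u \<in> borel_measurable \<mu>"
      using u(1) has_measure_derivativeD(1) by (auto simp: D2_triple_def sq_integrable_def)
    show "(\<lambda>y. \<phi> j y * u y) \<in> borel_measurable \<mu>"
      "(\<lambda>y. - \<Lambda> k * (\<phi> j y * \<phi> k y)) \<in> borel_measurable \<mu>"
      by measurable
    show "AE y in \<mu>. \<phi> j y * u y = - \<Lambda> k * (\<phi> j y * \<phi> k y)"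
      using u(2) by eventually_elim simp
  qed
  also have "\<dots> = - \<Lambda> k * (LINT y|\<mu>. \<phi> j y * \<phi> k y)"
    by (rule integral_mult_right_zero)
  finally show ?thesis
    by (simp add: orthonormal)
qed

lemma eigen_sum_norm:
  "(LINT y|\<mu>. (\<Sum>k<n. c k * \<phi> k y)\<^sup>2) = (\<Sum>k<n. (c k)\<^sup>2)"
proof -
  have int: "integrable \<mu> (\<lambda>y. \<phi> j y * \<phi> k y)" for j k
    using eigenfunction_C1 by (intro continuous_integrable continuous_intros) (auto dest: C1_pairD)
  have "(LINT y|\<mu>. (\<Sum>k<n. c k * \<phi> k y)\<^sup>2) =
      (LINT y|\<mu>. (\<Sum>j<n. \<Sum>k<n. c j * c k * (\<phi> j y * \<phi> k y)))"
    by (simp add: power2_eq_square sum_product mult_ac)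
  also have "\<dots> = (\<Sum>j<n. \<Sum>k<n. c j * c k * (LINT y|\<mu>. \<phi> j y * \<phi> k y))"
    using int by (subst Bochner_Integration.integral_sum, simp)+ simp
  also have "\<dots> = (\<Sum>k<n. (c k)\<^sup>2)"
    using sum_diagonal[of c "\<lambda>_. 1" n] by (simp add: orthonormal)
  finally show ?thesis .
qed

lemma eigen_sum_energy:
  "energy (\<lambda>x. \<Sum>k<n. c k * deriv01 (\<phi> k) x) = (\<Sum>k<n. \<Lambda> k * (c k)\<^sup>2)"
proof -
  let ?f = "\<lambda>j k x. deriv01 (\<phi> j) x * deriv01 (\<phi> k) x"
  have int: "?f j k integrable_on {0..1}" for j k
    using eigenfunction_C1
    by (intro integrable_continuous_interval continuous_intros) (auto dest: C1_pairD)
  have "((\<lambda>x. \<Sum>j<n. \<Sum>k<n. c j * c k * ?f j k x) has_integral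
      (\<Sum>j<n. \<Sum>k<n. c j * c k * integral {0..1} (?f j k))) {0..1}"
    using int by (intro has_integral_sum has_integral_mult_right integrable_integral) auto
  then have "energy (\<lambda>x. \<Sum>k<n. c k * deriv01 (\<phi> k) x) =
      (\<Sum>j<n. \<Sum>k<n. c j * c k * integral {0..1} (?f j k))"
    unfolding energy_def by (intro integral_unique) (simp add: power2_eq_square sum_product mult_ac)
  also have "\<dots> = (\<Sum>k<n. \<Lambda> k * (c k)\<^sup>2)"
    using sum_diagonal[of c \<Lambda> n] by (simp add: derivatives_orthogonal)
  finally show ?thesis .
qed

lemma eigen_sum_D2:
  "\<exists>u. D2_triple (\<lambda>x. \<Sum>k<n. c k * \<phi> k x) (\<lambda>x. \<Sum>k<n. c k * deriv01 (\<phi> k) x) u"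
proof -
  have "\<forall>k. \<exists>u. D2_triple (\<phi> k) (deriv01 (\<phi> k)) u"
    using eigenfunction_D2 by blast
  then obtain u where "\<And>k. D2_triple (\<phi> k) (deriv01 (\<phi> k)) (u k)"
    by metis
  then show ?thesis
    using D2_triple_sum[of \<phi> "\<lambda>k. deriv01 (\<phi> k)" u c n] by blast
qed

section \<open>The resolvent bound\<close>

text \<open>The coefficients \<open>c k = \<phi> k x / (1 + t * \<Lambda> k)\<close> are those for which the value of \<open>\<Sum> c\<^sub>k \<phi>\<^sub>k\<close> at \<open>x\<close> and
  the quantity \<open>\<parallel>f\<parallel>\<^sup>2 + t \<E> f\<close> are both the sum \<open>R\<close> to be bounded, so that the Sobolev inequality
  reads \<open>R\<^sup>2 \<le> B R\<close>.\<close>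

lemma resolvent_le:
  assumes T: "1 \<le> T" and t: "0 < t" "t \<le> T" and x: "x \<in> {0..1}"
  shows "(\<Sum>k<n. (\<phi> k x)\<^sup>2 / (1 + t * \<Lambda> k)) \<le> 2 / min_scale * T powr \<theta> * t powr (- \<theta>)"
proof -
  define c where "c = (\<lambda>k. \<phi> k x / (1 + t * \<Lambda> k))"
  define R where "R = (\<Sum>k<n. (\<phi> k x)\<^sup>2 / (1 + t * \<Lambda> k))"
  have pos: "0 < 1 + t * \<Lambda> k" for k
    using t eigenvalue_nonneg[of k] by (simp add: add_pos_nonneg)
  obtain u where u: "D2_triple (\<lambda>x. \<Sum>k<n. c k * \<phi> k x) (\<lambda>x. \<Sum>k<n. c k * deriv01 (\<phi> k) x) u"
    using eigen_sum_D2 by blast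
  have R: "(\<Sum>k<n. c k * \<phi> k x) = R"
    by (simp add: R_def c_def power2_eq_square)
  have "(\<Sum>k<n. (c k)\<^sup>2) + t * (\<Sum>k<n. \<Lambda> k * (c k)\<^sup>2) = (\<Sum>k<n. (1 + t * \<Lambda> k) * (c k)\<^sup>2)"
    by (simp add: distrib_right sum.distrib sum_distrib_left mult.assoc)
  also have "\<dots> = R"
    unfolding R_def
  proof (rule sum.cong[OF refl])
    fix k
    have "1 + t * \<Lambda> k \<noteq> 0"
      using pos[of k] by simp
    then show "(1 + t * \<Lambda> k) * (c k)\<^sup>2 = (\<phi> k x)\<^sup>2 / (1 + t * \<Lambda> k)"
      by (simp add: c_def power2_eq_square)
  qed
  finally have "R\<^sup>2 \<le> 2 / min_scale * T powr \<theta> * t powr (- \<theta>) * R"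
    using sobolev_upto[OF u T t x] unfolding R eigen_sum_norm eigen_sum_energy by (simp only:)
  moreover have "0 \<le> R"
    unfolding R_def using pos by (intro sum_nonneg divide_nonneg_pos) auto
  moreover have "0 \<le> 2 / min_scale * T powr \<theta> * t powr (- \<theta>)"
    using min_scale_range by simp
  ultimately show ?thesis
    unfolding R_def[symmetric] by (rule le_of_square_le_mult)
qed

lemma heat_partial_sum_le:
  assumes T: "1 \<le> T" and t: "0 < t" "t \<le> T" and x: "x \<in> {0..1}"
  shows "(\<Sum>k<n. exp (- \<Lambda> k * t) * (\<phi> k x)\<^sup>2) \<le> 2 / min_scale * T powr \<theta> * t powr (- \<theta>)"
proof -
  have "exp (- \<Lambda> k * t) * (\<phi> k x)\<^sup>2 \<le> (\<phi> k x)\<^sup>2 / (1 + t * \<Lambda> k)" for k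
    using mult_right_mono[OF exp_minus_le_resolvent, of "t * \<Lambda> k" "(\<phi> k x)\<^sup>2"] t
      eigenvalue_nonneg[of k]
    by (simp add: mult.commute)
  then have "(\<Sum>k<n. exp (- \<Lambda> k * t) * (\<phi> k x)\<^sup>2) \<le> (\<Sum>k<n. (\<phi> k x)\<^sup>2 / (1 + t * \<Lambda> k))"
    by (rule sum_mono)
  also have "\<dots> \<le> 2 / min_scale * T powr \<theta> * t powr (- \<theta>)"
    using assms by (rule resolvent_le)
  finally show ?thesis .
qed

text \<open>The inequality \<open>2 \<bar>a b\<bar> \<le> a\<^sup>2 + b\<^sup>2\<close> reduces the kernel at \<open>(x, y)\<close> to its values on the diagonal.
  The absolute values inside the sum also give the convergence of the series.\<close>

lemma heat_product_partial_sum_le: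
  assumes T: "1 \<le> T" and t: "0 < t" "t \<le> T" and x: "x \<in> {0..1}" and y: "y \<in> {0..1}"
  shows "(\<Sum>k<n. \<bar>exp (- \<Lambda> k * t) * \<phi> k x * \<phi> k y\<bar>) \<le> 2 / min_scale * T powr \<theta> * t powr (- \<theta>)"
proof -
  have "\<bar>exp (- \<Lambda> k * t) * \<phi> k x * \<phi> k y\<bar> \<le>
      (exp (- \<Lambda> k * t) * (\<phi> k x)\<^sup>2 + exp (- \<Lambda> k * t) * (\<phi> k y)\<^sup>2) / 2" for k
  proof -
    have "2 * \<bar>\<phi> k x * \<phi> k y\<bar> \<le> (\<phi> k x)\<^sup>2 + (\<phi> k y)\<^sup>2"
      using zero_le_power2[of "\<bar>\<phi> k x\<bar> - \<bar>\<phi> k y\<bar>"] by (simp add: power2_diff abs_mult)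
    then have "exp (- \<Lambda> k * t) * (2 * \<bar>\<phi> k x * \<phi> k y\<bar>) \<le>
        exp (- \<Lambda> k * t) * ((\<phi> k x)\<^sup>2 + (\<phi> k y)\<^sup>2)"
      by (intro mult_left_mono) auto
    then show ?thesis
      by (simp add: abs_mult algebra_simps)
  qed
  then have "(\<Sum>k<n. \<bar>exp (- \<Lambda> k * t) * \<phi> k x * \<phi> k y\<bar>) \<le>
      (\<Sum>k<n. (exp (- \<Lambda> k * t) * (\<phi> k x)\<^sup>2 + exp (- \<Lambda> k * t) * (\<phi> k y)\<^sup>2) / 2)"
    by (rule sum_mono)
  also have "\<dots> = ((\<Sum>k<n. exp (- \<Lambda> k * t) * (\<phi> k x)\<^sup>2) +
      (\<Sum>k<n. exp (- \<Lambda> k * t) * (\<phi> k y)\<^sup>2)) / 2"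
    by (simp add: sum.distrib flip: sum_divide_distrib)
  also have "\<dots> \<le> 2 / min_scale * T powr \<theta> * t powr (- \<theta>)"
    using add_mono[OF heat_partial_sum_le[OF T t x, of n] heat_partial_sum_le[OF T t y, of n]]
    by simp
  finally show ?thesis .
qed

lemma heat_summable:
  assumes t: "0 < t" and x: "x \<in> {0..1}" and y: "y \<in> {0..1}"
  shows "summable (\<lambda>k. exp (- \<Lambda> k * t) * \<phi> k x * \<phi> k y)"
proof (rule summable_rabs_cancel, rule bounded_imp_summable)
  fix n
  show "(\<Sum>k\<le>n. \<bar>exp (- \<Lambda> k * t) * \<phi> k x * \<phi> k y\<bar>) \<le> 2 / min_scale * (max 1 t) powr \<theta> * t powr (- \<theta>)"
    using heat_product_partial_sum_le[OF _ t _ x y, of "max 1 t" "Suc n"]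
    by (simp add: lessThan_Suc_atMost del: sum.lessThan_Suc)
qed simp

lemma heat_kernel_LIMSEQ:
  assumes "0 < t" "x \<in> {0..1}" "y \<in> {0..1}"
  shows "(\<lambda>n. \<Sum>k<n. exp (- \<Lambda> k * t) * \<phi> k x * \<phi> k y) \<longlonglongrightarrow> heat_kernel \<Lambda> \<phi> t x y"
  unfolding heat_kernel_def using heat_summable[OF assms] by (rule summable_LIMSEQ)

lemma heat_kernel_le:
  assumes "1 \<le> T" "0 < t" "t \<le> T" "x \<in> {0..1}" "y \<in> {0..1}"
  shows "heat_kernel \<Lambda> \<phi> t x y \<le> 2 / min_scale * T powr \<theta> * t powr (- \<theta>)"
proof (rule LIMSEQ_le_const2[OF heat_kernel_LIMSEQ])
  show "\<exists>N. \<forall>n\<ge>N. (\<Sum>k<n. exp (- \<Lambda> k * t) * \<phi> k x * \<phi> k y) \<le> 2 / min_scale * T powr \<theta> * t powr (- \<theta>)"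
    using order_trans[OF sum_mono[OF abs_ge_self] heat_product_partial_sum_le[OF assms]] by blast
qed (use assms in auto)

lemma eigen_sum_holder:
  assumes "x \<in> {0..1}" "y \<in> {0..1}"
  shows "((\<Sum>k<n. c k * \<phi> k x) - (\<Sum>k<n. c k * \<phi> k y))\<^sup>2 \<le> \<bar>x - y\<bar> * (\<Sum>k<n. \<Lambda> k * (c k)\<^sup>2)"
proof -
  have "C1_pair (\<lambda>x. \<Sum>k<n. c k * \<phi> k x) (\<lambda>x. \<Sum>k<n. c k * deriv01 (\<phi> k) x)"
    using eigen_sum_D2[where n = n and c = c] unfolding D2_triple_def by blast
  from square_diff_le_energy[OF this assms] show ?thesis
    by (simp add: eigen_sum_energy)
qed

text \<open>For fixed \<open>y\<close> the partial sums are eigenfunction sums with coefficients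
  \<open>c k = exp (- \<Lambda> k * t) * \<phi> k y\<close>. By the resolvent bound their energy is at most
  \<open>C t powr (- 1 - \<theta>)\<close>, and the square root of the energy is a Hoelder constant of order \<open>1/2\<close>.\<close>

lemma heat_kernel_holder:
  assumes T: "1 \<le> T" and t: "0 < t" "t \<le> T" and x: "x \<in> {0..1}" "x' \<in> {0..1}" and y: "y \<in> {0..1}"
  shows "\<bar>heat_kernel \<Lambda> \<phi> t x y - heat_kernel \<Lambda> \<phi> t x' y\<bar> \<le>
    sqrt (2 / min_scale * T powr \<theta>) * \<bar>x - x'\<bar> powr (1/2) * t powr (- 1/2 - \<theta> / 2)"
proof (rule LIMSEQ_le_const2)
  let ?p = "\<lambda>n x. \<Sum>k<n. exp (- \<Lambda> k * t) * \<phi> k x * \<phi> k y"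
  let ?B = "2 / min_scale * T powr \<theta>"
  show "(\<lambda>n. \<bar>?p n x - ?p n x'\<bar>) \<longlonglongrightarrow> \<bar>heat_kernel \<Lambda> \<phi> t x y - heat_kernel \<Lambda> \<phi> t x' y\<bar>"
    using assms by (intro tendsto_rabs tendsto_diff heat_kernel_LIMSEQ)
  have "\<bar>?p n x - ?p n x'\<bar> \<le> sqrt ?B * \<bar>x - x'\<bar> powr (1/2) * t powr (- 1/2 - \<theta> / 2)" for n
  proof -
    define c where "c = (\<lambda>k. exp (- \<Lambda> k * t) * \<phi> k y)"
    have "\<Lambda> k * (c k)\<^sup>2 \<le> 1 / t * ((\<phi> k y)\<^sup>2 / (1 + t * \<Lambda> k))" for k
    proof -
      define v where "v = t * \<Lambda> k"
      have v: "0 \<le> v"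
        using t eigenvalue_nonneg by (simp add: v_def)
      have "t * (\<Lambda> k * (c k)\<^sup>2) = v * (exp (- v))\<^sup>2 * (\<phi> k y)\<^sup>2"
        by (simp add: c_def v_def power_mult_distrib mult_ac)
      also have "\<dots> \<le> 1 / (1 + v) * (\<phi> k y)\<^sup>2"
        using mult_exp_minus_square_le_resolvent[OF v] by (rule mult_right_mono) simp
      also have "\<dots> = (\<phi> k y)\<^sup>2 / (1 + t * \<Lambda> k)"
        by (simp add: v_def)
      finally show ?thesis
        by (rule le_one_div_mult[OF t(1)])
    qed
    then have "(\<Sum>k<n. \<Lambda> k * (c k)\<^sup>2) \<le> (\<Sum>k<n. 1 / t * ((\<phi> k y)\<^sup>2 / (1 + t * \<Lambda> k)))"
      by (rule sum_mono)
    also have "\<dots> = 1 / t * (\<Sum>k<n. (\<phi> k y)\<^sup>2 / (1 + t * \<Lambda> k))"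
      by (rule sum_distrib_left[symmetric])
    also have "\<dots> \<le> 1 / t * (?B * t powr (- \<theta>))"
      using t by (intro mult_left_mono resolvent_le[OF T t y]) auto
    finally have energy: "(\<Sum>k<n. \<Lambda> k * (c k)\<^sup>2) \<le> 1 / t * (?B * t powr (- \<theta>))" .
    have "(?p n x - ?p n x')\<^sup>2 \<le> \<bar>x - x'\<bar> * (\<Sum>k<n. \<Lambda> k * (c k)\<^sup>2)"
      using eigen_sum_holder[OF x, of c n] by (simp add: c_def mult_ac)
    also have "\<dots> \<le> \<bar>x - x'\<bar> * (1 / t * (?B * t powr (- \<theta>)))"
      using energy by (intro mult_left_mono) auto
    also have "\<dots> = ?B * \<bar>x - x'\<bar> * t powr (- 1 - \<theta>)"
    proof -
      have "1 / t * t powr (- \<theta>) = t powr (- 1 - \<theta>)"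
        using t by (simp add: powr_diff powr_minus field_simps)
      then show ?thesis
        by (metis mult.commute mult.left_commute)
    qed
    finally have "\<bar>?p n x - ?p n x'\<bar> \<le> sqrt (?B * \<bar>x - x'\<bar> * t powr (- 1 - \<theta>))"
      by (simp add: real_le_rsqrt)
    also have "\<dots> = sqrt ?B * \<bar>x - x'\<bar> powr (1/2) * t powr (- 1/2 - \<theta> / 2)"
    proof -
      have "sqrt (t powr (- 1 - \<theta>)) = t powr (- 1/2 - \<theta> / 2)"
        using t by (simp add: powr_half_sqrt[symmetric] powr_powr diff_divide_distrib)
      then show ?thesis
        by (simp only: real_sqrt_mult powr_half_sqrt abs_ge_zero)
    qed
    finally show ?thesis .
  qed
  then show "\<exists>N. \<forall>n\<ge>N. \<bar>?p n x - ?p n x'\<bar> \<le> sqrt ?B * \<bar>x - x'\<bar> powr (1/2) * t powr (- 1/2 - \<theta> / 2)"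
    by blast
qed

text \<open>The time derivative of each partial sum is at most \<open>K \<theta> \<tau> powr (- \<theta> - 1)\<close> in modulus, which is
  minus the derivative of \<open>K \<tau> powr (- \<theta>)\<close>. Hence \<open>K \<tau> powr (- \<theta>)\<close> minus the partial sum is
  nonincreasing, and comparing its values at \<open>s\<close> and \<open>t\<close> replaces an integration over \<open>[s,t]\<close>.\<close>

lemma heat_kernel_time_difference:
  assumes T: "1 \<le> T" and st: "0 < s" "s \<le> t" "t \<le> T" and x: "x \<in> {0..1}"
  shows "\<bar>heat_kernel \<Lambda> \<phi> s x x - heat_kernel \<Lambda> \<phi> t x x\<bar> \<le>
    8 / (min_scale * \<theta>) * T powr \<theta> * (s powr (- \<theta>) - t powr (- \<theta>))"
proof (rule LIMSEQ_le_const2)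
  let ?p = "\<lambda>n t. \<Sum>k<n. exp (- \<Lambda> k * t) * \<phi> k x * \<phi> k x"
  define K where "K = 8 / (min_scale * \<theta>) * T powr \<theta>"
  show "(\<lambda>n. \<bar>?p n s - ?p n t\<bar>) \<longlonglongrightarrow> \<bar>heat_kernel \<Lambda> \<phi> s x x - heat_kernel \<Lambda> \<phi> t x x\<bar>"
    using assms by (intro tendsto_rabs tendsto_diff heat_kernel_LIMSEQ) auto
  have "\<bar>?p n s - ?p n t\<bar> \<le> K * (s powr (- \<theta>) - t powr (- \<theta>))" for n
  proof -
    have "?p n t \<le> ?p n s"
      using st eigenvalue_nonneg unfolding mult.assoc
      by (intro sum_mono mult_right_mono) (auto intro: mult_left_mono)
    moreover have "K * t powr (- \<theta>) - ?p n t \<le> K * s powr (- \<theta>) - ?p n s"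
    proof (rule DERIV_nonpos_imp_nonincreasing[OF st(2)])
      fix \<tau> assume "s \<le> \<tau>" "\<tau> \<le> t"
      then have \<tau>: "0 < \<tau>" "\<tau> \<le> T"
        using st by auto
      let ?d = "K * (- \<theta> * \<tau> powr (- \<theta> - 1)) - (\<Sum>k<n. exp (- \<Lambda> k * \<tau>) * (- \<Lambda> k) * (\<phi> k x * \<phi> k x))"
      have "((\<lambda>\<tau>. K * \<tau> powr (- \<theta>) - ?p n \<tau>) has_real_derivative ?d) (at \<tau>)"
        unfolding mult.assoc[of _ "\<phi> _ x"]
      proof (intro DERIV_diff DERIV_cmult DERIV_sum DERIV_cmult_right)
        show "((\<lambda>\<tau>. \<tau> powr (- \<theta>)) has_real_derivative - \<theta> * \<tau> powr (- \<theta> - 1)) (at \<tau>)"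
          using \<tau> by (auto intro!: derivative_eq_intros)
        show "((\<lambda>\<tau>. exp (- \<Lambda> k * \<tau>)) has_real_derivative exp (- \<Lambda> k * \<tau>) * (- \<Lambda> k)) (at \<tau>)" for k
          by (auto intro!: derivative_eq_intros)
      qed
      moreover have "?d \<le> 0"
      proof -
        have "\<Lambda> k * exp (- \<Lambda> k * \<tau>) * (\<phi> k x)\<^sup>2 \<le> 4 / \<tau> * ((\<phi> k x)\<^sup>2 / (1 + \<tau> * \<Lambda> k))" for k
        proof -
          define v where "v = \<tau> * \<Lambda> k"
          have v: "0 \<le> v"
            using \<tau> eigenvalue_nonneg by (simp add: v_def)
          have "\<tau> * (\<Lambda> k * exp (- \<Lambda> k * \<tau>) * (\<phi> k x)\<^sup>2) = v * exp (- v) * (\<phi> k x)\<^sup>2"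
            by (simp add: v_def mult_ac)
          also have "\<dots> \<le> 4 * (1 / (1 + v)) * (\<phi> k x)\<^sup>2"
            using mult_exp_minus_le_resolvent[OF v] by (rule mult_right_mono) simp
          also have "\<dots> = 4 * ((\<phi> k x)\<^sup>2 / (1 + \<tau> * \<Lambda> k))"
            by (simp add: v_def)
          finally have "\<Lambda> k * exp (- \<Lambda> k * \<tau>) * (\<phi> k x)\<^sup>2 \<le>
              1 / \<tau> * (4 * ((\<phi> k x)\<^sup>2 / (1 + \<tau> * \<Lambda> k)))"
            by (rule le_one_div_mult[OF \<tau>(1)])
          then show ?thesis
            by simp
        qed
        then have "(\<Sum>k<n. \<Lambda> k * exp (- \<Lambda> k * \<tau>) * (\<phi> k x)\<^sup>2) \<le>
            (\<Sum>k<n. 4 / \<tau> * ((\<phi> k x)\<^sup>2 / (1 + \<tau> * \<Lambda> k)))"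
          by (rule sum_mono)
        also have "\<dots> = 4 / \<tau> * (\<Sum>k<n. (\<phi> k x)\<^sup>2 / (1 + \<tau> * \<Lambda> k))"
          by (rule sum_distrib_left[symmetric])
        also have "\<dots> \<le> 4 / \<tau> * (2 / min_scale * T powr \<theta> * \<tau> powr (- \<theta>))"
          using \<tau> by (intro mult_left_mono resolvent_le[OF T \<tau> x]) auto
        also have "\<dots> = K * \<theta> * \<tau> powr (- \<theta> - 1)"
          using \<tau> theta_range by (simp add: K_def powr_diff mult.commute)
        finally show ?thesis
          by (simp add: sum_negf power2_eq_square mult_ac)
      qed
      ultimately show "\<exists>d. ((\<lambda>\<tau>. K * \<tau> powr (- \<theta>) - ?p n \<tau>) has_real_derivative d) (at \<tau>) \<and> d \<le> 0"
        by blast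
    qed
    ultimately show ?thesis
      by (simp add: algebra_simps)
  qed
  then show "\<exists>N. \<forall>n\<ge>N. \<bar>?p n s - ?p n t\<bar> \<le>
      8 / (min_scale * \<theta>) * T powr \<theta> * (s powr (- \<theta>) - t powr (- \<theta>))"
    unfolding K_def by blast
qed

end

theorem proposition2p9:
  fixes N :: nat and r b m :: "nat \<Rightarrow> real" and \<mu> :: "real measure" and \<gamma> \<delta> :: real
    and \<beta> :: boundary and \<Lambda> :: "nat \<Rightarrow> real" and \<phi> :: "nat \<Rightarrow> real \<Rightarrow> real" and T :: real
  assumes "affine_ifs N r b"
    and "probability_weights N m"
    and "self_similar_measure N r b m \<mu>"
    and "\<gamma> = spectral_exponent N r m"
    and "\<delta> = spectral_delta N r m"
    and "eigenbasis \<mu> \<beta> \<Lambda> \<phi>"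
    and "0 < T"
  shows "(\<exists>C5>0. \<forall>t\<in>{0<..T}. \<forall>x\<in>{0..1}. \<forall>y\<in>{0..1}.
            heat_kernel \<Lambda> \<phi> t x y \<le> C5 * t powr (- \<gamma> * \<delta>)) \<and>
         (\<exists>C6>0. \<forall>t\<in>{0<..T}. \<forall>x\<in>{0..1}. \<forall>x'\<in>{0..1}. \<forall>y\<in>{0..1}.
            \<bar>heat_kernel \<Lambda> \<phi> t x y - heat_kernel \<Lambda> \<phi> t x' y\<bar>
              \<le> C6 * \<bar>x - x'\<bar> powr (1/2) * t powr (- 1/2 - \<gamma> * \<delta> / 2)) \<and>
         (\<exists>C7>0. \<forall>s\<in>{0<..T}. \<forall>t\<in>{0<..T}. \<forall>x\<in>{0..1}. s \<le> t \<longrightarrow>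
            \<bar>heat_kernel \<Lambda> \<phi> s x x - heat_kernel \<Lambda> \<phi> t x x\<bar>
              \<le> C7 * (s powr (- \<gamma> * \<delta>) - t powr (- \<gamma> * \<delta>)))"
proof -
  interpret self_similar_eigenbasis N r b m \<mu> \<beta> \<Lambda> \<phi>
    using assms by unfold_locales
  \<comment> \<open>The estimates above are stated for time horizons of at least \<open>1\<close>.\<close>
  define T' where "T' = max 1 T"
  have T': "1 \<le> T'" "T \<le> T'"
    by (auto simp: T'_def)
  have \<gamma>\<delta>: "\<gamma> * \<delta> = \<theta>"
    using assms spectral_exponent_times_delta by simp
  then have exponent: "- \<gamma> * \<delta> = - \<theta>" "- 1/2 - \<gamma> * \<delta> / 2 = - 1/2 - \<theta> / 2"
    by simp_all
  show ?thesis
    unfolding exponent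
  proof (intro conjI)
    show "\<exists>C5>0. \<forall>t\<in>{0<..T}. \<forall>x\<in>{0..1}. \<forall>y\<in>{0..1}.
        heat_kernel \<Lambda> \<phi> t x y \<le> C5 * t powr (- \<theta>)"
      using heat_kernel_le[OF T'(1)] T' min_scale_range
      by (intro exI[of _ "2 / min_scale * T' powr \<theta>"]) auto
    show "\<exists>C6>0. \<forall>t\<in>{0<..T}. \<forall>x\<in>{0..1}. \<forall>x'\<in>{0..1}. \<forall>y\<in>{0..1}.
        \<bar>heat_kernel \<Lambda> \<phi> t x y - heat_kernel \<Lambda> \<phi> t x' y\<bar>
          \<le> C6 * \<bar>x - x'\<bar> powr (1/2) * t powr (- 1/2 - \<theta> / 2)"
      using heat_kernel_holder[OF T'(1)] T' min_scale_range
      by (intro exI[of _ "sqrt (2 / min_scale * T' powr \<theta>)"]) auto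
    show "\<exists>C7>0. \<forall>s\<in>{0<..T}. \<forall>t\<in>{0<..T}. \<forall>x\<in>{0..1}. s \<le> t \<longrightarrow>
        \<bar>heat_kernel \<Lambda> \<phi> s x x - heat_kernel \<Lambda> \<phi> t x x\<bar>
          \<le> C7 * (s powr (- \<theta>) - t powr (- \<theta>))"
      using heat_kernel_time_difference[OF T'(1)] T' min_scale_range theta_range
      by (intro exI[of _ "8 / (min_scale * \<theta>) * T' powr \<theta>"]) auto
  qed
qed

end
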